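(* Consider the online case $f(x)=\frac1n\sum_{i=1}^n f_i(x)$, $f_i(x)=\mathbf{E}_{\xi_i\sim\mathcal{D}_i}[f_{\xi_i}(x)]$, $x\in\mathbb{R}^d$. Assume there exists $f_*\in\mathbb{R}$ with $f(x)\ge f_*$ for all $x\in\mathbb{R}^d$; that $f_i$ is $L_i$-smooth for all $i\in\{1,\dots,n\}$, i.e. $\|\nabla f_i(x)-\nabla f_i(y)\|\le L_i\|x-y\|$ for all $x,y\in\mathbb{R}^d$; that the average $\mathcal{L}$-smoothness assumption (see context) holds with constants $\mathcal{L}_i\ge0$; that $f$ satisfies the Polyak–Łojasiewicz condition with parameter $\mu$, i.e. $\|\nabla f(x)\|^2\ge2\mu(f(x)-f(x^* ))$ for all $x\in\mathbb{R}^d$, where $x^*=\arg\min_{x\in\mathbb{R}^d}f(x)$; and that for all $i$ there exists $\sigma_i\in[0,+\infty)$ such that for all $x\in\mathbb{R}^d$, $\mathbf{E}_{\xi_i\sim\mathcal{D}_i}[\nabla f_{\xi_i}(x)]=\nabla f_i(x)$ and $\mathbf{E}_{\xi_i\sim\mathcal{D}_i}[\|\nabla f_{\xi_i}(x)-\nabla f_i(x)\|^2]\le\sigma_i^2$. Put $L^2=\frac1n\sum_{i=1}^nL_i^2$, $\mathcal{L}^2=\frac1n\sum_{i=1}^n\mathcal{L}_i^2$ and $\Delta_0=f(x^0)-f(x^* )$. Let $\mathcal{Q}$ be a quantization operator with parameter $\omega$ and expected density $\zeta_{\mathcal Q}$, and let $p=\min\left\{\frac{\zeta_{\mathcal Q}}{d},\frac{b'}{b+b'}\right\}$,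 where $b'\le b$. If $$\gamma\le\min\left\{\frac{1}{L+\sqrt{\frac{2\max\{d/\zeta_{\mathcal Q}-1,\,b/b'\}}{n}\left(\omega L^2+\frac{(1+\omega)\mathcal{L}^2}{b'}\right)}},\frac{p}{2\mu}\right\}$$ and $$b=\Theta\left(\frac{\sigma^2}{n\mu\varepsilon}\right),\qquad\sigma^2=\frac1n\sum_{i=1}^n\sigma_i^2,$$ then VR-MARINA (online case) requires $$\mathcal{O}\left(\max\left\{\frac d{\zeta_{\mathcal Q}},\frac{\sigma^2}{nb'\mu\varepsilon},\frac L\mu\left(1+\sqrt{\frac\omega n\max\left\{\frac d{\zeta_{\mathcal Q}}-1,\frac{\sigma^2}{nb'\mu\varepsilon}\right\}}\right)+\frac{\mathcal{L}}{\mu}\sqrt{\frac{1+\omega}{nb'}\max\left\{\frac d{\zeta_{\mathcal Q}}-1,\frac{\sigma^2}{nb'\mu\varepsilon}\right\}}\right\}\log\frac{\Delta_0}{\varepsilon}\right)$$ iterations/communication rounds, $$\mathcal{O}\left(\max\left\{\frac{b'd}{\zeta_{\mathcal Q}},\frac{\sigma^2}{n\mu\varepsilon},\frac L\mu\left(b'+\sqrt{\frac{\omega b'}n\max\left\{\left(\frac d{\zeta_{\mathcal Q}}-1\right)b',\frac{\sigma^2}{n\mu\varepsilon}\right\}}\right)+\frac{\mathcal{L}}{\mu}\sqrt{\frac{1+\omega}{n}\max\left\{\left(\frac d{\zeta_{\mathcal Q}}-1\right)b',\frac{\sigma^2}{n\mu\varepsilon}\right\}}\right\}\log\frac{\Delta_0}{\varepsilon}\right)$$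 stochastic oracle calls per node in expectation to achieve $\mathbf{E}[f(x^K)-f(x^* )]\le\varepsilon$, and the expected total communication cost per worker is $$\mathcal{O}\left(\zeta_{\mathcal Q}\max\left\{\frac d{\zeta_{\mathcal Q}},\frac{\sigma^2}{nb'\mu\varepsilon},\frac L\mu\left(1+\sqrt{\frac\omega n\max\left\{\frac d{\zeta_{\mathcal Q}}-1,\frac{\sigma^2}{nb'\mu\varepsilon}\right\}}\right)+\frac{\mathcal{L}}{\mu}\sqrt{\frac{1+\omega}{nb'}\max\left\{\frac d{\zeta_{\mathcal Q}}-1,\frac{\sigma^2}{nb'\mu\varepsilon}\right\}}\right\}\log\frac{\Delta_0}{\varepsilon}\right)$$ under an assumption that the communication cost is proportional to the number of non-zero components of transmitted vectors from workers to the server.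
   Context: $\|\cdot\|$ is the Euclidean norm; $\|y\|_0$ is the number of non-zero components of $y\in\mathbb{R}^d$. Quantization operator: a stochastic mapping $\mathcal{Q}:\mathbb{R}^d\to\mathbb{R}^d$ for which there is $\omega>0$ with $\mathbf{E}[\mathcal{Q}(x)]=x$ and $\mathbf{E}[\|\mathcal{Q}(x)-x\|^2]\le\omega\|x\|^2$ for any $x\in\mathbb{R}^d$. Its expected density is $\zeta_{\mathcal Q}=\sup_{x\in\mathbb{R}^d}\mathbf{E}[\|\mathcal{Q}(x)\|_0]$. VR-MARINA, online case (a distributed method with $n$ workers and a server; input: starting point $x^0$, stepsize $\gamma$, minibatch sizes $b,b'$, probability $p\in(0,1]$, number of iterations $K$): initialize $g^0=\frac1{nb}\sum_{i=1}^n\sum_{j\in I_{i,0}}\nabla f_{\xi_{ij}^0}(x^0)$, where $I_{i,0}$ is the set of the indices in the minibatch, $|I_{i,0}|=b$. For $k=0,\dots,K-1$: sample $c_k\sim\mathrm{Bernoulli}(p)$ and broadcast $g^k$ to all workers; each worker $i=1,\dots,n$ in parallel computes $x^{k+1}=x^k-\gamma g^k$ and sets $g_i^{k+1}=\frac1b\sum_{j\in I_{i,k}}\nabla f_{\xi_{ij}^k}(x^{k+1})$ if $c_k=1$, and $g_i^{k+1}=g^k+\mathcal{Q}(\widetilde\Delta_i^k)$ if $c_k=0$, where $\widetilde\Delta_i^k=\frac1{b'}\sum_{j\in I'_{i,k}}(\nabla f_{\xi_{ij}^k}(x^{k+1})-\nabla f_{\xi_{ij}^k}(x^k))$ and $I_{i,k},I'_{i,k}$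 are the sets of the indices in the minibatches, $|I_{i,k}|=b$, $|I'_{i,k}|=b'$; then $g^{k+1}=\frac1n\sum_{i=1}^n g_i^{k+1}$. Here the $\xi_{ij}^k$ are independently sampled from $\mathcal{D}_i$. The point considered here is the last iterate $x^K$. Average $\mathcal{L}$-smoothness: for all $k\ge0$ and $i\in\{1,\dots,n\}$, with $\Delta_i^k=\nabla f_i(x^{k+1})-\nabla f_i(x^k)$, one has $\mathbf{E}[\widetilde\Delta_i^k\mid x^k,x^{k+1}]=\Delta_i^k$ and $\mathbf{E}[\|\widetilde\Delta_i^k-\Delta_i^k\|^2\mid x^k,x^{k+1}]\le\frac{\mathcal{L}_i^2}{b'}\|x^{k+1}-x^k\|^2$ with some $\mathcal{L}_i\ge0$. A stochastic oracle call is the computation of one stochastic gradient $\nabla f_{\xi}$ at one point.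
   Formalization: The O-bounds fail for γ→0, for too small a constant in b=Θ(σ²/(nμε)), and at Δ₀=ε. So γ is also at least θ times its bound, b ≥ 3σ²/(nμε), and Δ₀ ≥ ρε with ρ>1; the hidden constant depends on θ, ρ and the upper Θ-constant of b. *)

theory Defs
  imports "HOL-Probability.Probability"
begin

definition grad :: "('a::real_inner \<Rightarrow> real) \<Rightarrow> 'a \<Rightarrow> 'a" where
  "grad f x = (THE v. GDERIV f x :> v)"

lemma GDERIV_grad:
  fixes f :: "'a::euclidean_space \<Rightarrow> real"
  assumes "f differentiable (at x)"
  shows "GDERIV f x :> grad f x"
proof -
  obtain f' where f': "(f has_derivative f') (at x)"
    using assms by (auto simp: differentiable_def)
  then interpret linear f'
    by (rule has_derivative_linear)
  define v where "v = (\<Sum>b\<in>Basis. f' b *\<^sub>R b)"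
  have "f' h = h \<bullet> v" for h
  proof -
    have "f' h = f' (\<Sum>b\<in>Basis. (h \<bullet> b) *\<^sub>R b)"
      by (simp add: euclidean_representation)
    also have "\<dots> = (\<Sum>b\<in>Basis. (h \<bullet> b) *\<^sub>R f' b)"
      by (simp add: sum scale)
    also have "\<dots> = h \<bullet> v"
      by (simp add: v_def inner_sum_right mult.commute)
    finally show ?thesis .
  qed
  then have "f' = (\<lambda>h. h \<bullet> v)" by auto
  with f' have v: "GDERIV f x :> v"
    by (simp add: gderiv_def)
  have "u = v" if "GDERIV f x :> u" for u
  proof -
    have "(\<lambda>h. h \<bullet> u) = (\<lambda>h. h \<bullet> v)"
      using that v unfolding gderiv_def by (rule has_derivative_unique)
    then show ?thesis
      by (metis vector_eq_ldot)
  qed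
  with v show ?thesis
    unfolding grad_def by (rule theI)
qed

definition smooth_with :: "real \<Rightarrow> ('a::real_inner \<Rightarrow> real) \<Rightarrow> bool" where
  "smooth_with L f \<longleftrightarrow>
     (\<forall>x. f differentiable (at x)) \<and> (\<forall>x y. norm (grad f x - grad f y) \<le> L * norm (x - y))"

definition nnz :: "real ^ 'd::finite \<Rightarrow> nat" where
  "nnz y = card {l. y $ l \<noteq> 0}"

text \<open>A stochastic mapping is a jointly measurable function \<open>Q r x\<close> of the point \<open>x\<close> and of a
  random seed \<open>r\<close> with law \<open>R\<close>; a fresh independent application of the mapping uses a fresh
  independent seed.\<close>

definition quantization ::
    "'r measure \<Rightarrow> ('r \<Rightarrow> real ^ 'd \<Rightarrow> real ^ 'd::finite) \<Rightarrow> real \<Rightarrow> bool" where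
  "quantization R Q \<omega> \<longleftrightarrow>
     prob_space R \<and> (\<lambda>(r, x). Q r x) \<in> borel_measurable (R \<Otimes>\<^sub>M borel) \<and> 0 < \<omega> \<and>
     (\<forall>x. integrable R (\<lambda>r. Q r x) \<and> (LINT r|R. Q r x) = x \<and>
          integrable R (\<lambda>r. (norm (Q r x - x))\<^sup>2) \<and>
          (LINT r|R. (norm (Q r x - x))\<^sup>2) \<le> \<omega> * (norm x)\<^sup>2)"

definition expected_density ::
    "'r measure \<Rightarrow> ('r \<Rightarrow> real ^ 'd \<Rightarrow> real ^ 'd::finite) \<Rightarrow> real" where
  "expected_density R Q = (SUP x. LINT r|R. real (nnz (Q r x)))"

definition minibatch_grad ::
    "('s \<Rightarrow> real ^ 'd \<Rightarrow> real) \<Rightarrow> nat set \<Rightarrow> (nat \<Rightarrow> 's) \<Rightarrow> real ^ 'd \<Rightarrow> real ^ 'd::finite" where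
  "minibatch_grad F S s x = (1 / real (card S)) *\<^sub>R (\<Sum>j\<in>S. grad (F (s j)) x)"

text \<open>The elementary sources of randomness: the coin \<open>c\<^sub>k\<close>, the sample \<open>\<xi>\<close> number \<open>j\<close> of worker \<open>i\<close>
  in batch \<open>k\<close>, and the seed of the quantization performed by worker \<open>i\<close> in iteration \<open>k\<close>.

  Batch \<open>0\<close> is the one used for \<open>g\<^sup>0\<close>, and iteration \<open>k\<close> (which produces \<open>x\<^sup>k\<^sup>+\<^sup>1\<close> and \<open>g\<^sup>k\<^sup>+\<^sup>1\<close>)
  uses batch \<open>k + 1\<close>. The shift keeps the batch used for \<open>g\<^sup>0\<close> and the one used in iteration \<open>0\<close>
  apart: every iteration draws fresh samples.\<close>

datatype source = Coin nat | Sample nat nat nat | Seed nat nat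

definition vr_marina_sampling ::
    "'w measure \<Rightarrow> (nat \<Rightarrow> 's measure) \<Rightarrow> 'r measure \<Rightarrow> nat \<Rightarrow> real \<Rightarrow>
     (nat \<Rightarrow> nat \<Rightarrow> nat set) \<Rightarrow> (nat \<Rightarrow> nat \<Rightarrow> nat set) \<Rightarrow>
     (nat \<Rightarrow> 'w \<Rightarrow> bool) \<Rightarrow> (nat \<Rightarrow> nat \<Rightarrow> nat \<Rightarrow> 'w \<Rightarrow> 's) \<Rightarrow> (nat \<Rightarrow> nat \<Rightarrow> 'w \<Rightarrow> 'r) \<Rightarrow> bool" where
  "vr_marina_sampling M D R n p I I' c \<xi> r \<longleftrightarrow>
     prob_space M \<and>
     (\<forall>k. c k \<in> measurable M (count_space UNIV) \<and>
          distr M (count_space UNIV) (c k) = measure_pmf (bernoulli_pmf p)) \<and>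
     (\<forall>i\<in>{1..n}. \<forall>k. \<forall>j\<in>I i k \<union> I' i k.
          \<xi> i j k \<in> measurable M (D i) \<and> distr M (D i) (\<xi> i j k) = D i) \<and>
     (\<forall>i\<in>{1..n}. \<forall>k. r i k \<in> measurable M R \<and> distr M R (r i k) = R) \<and>
     prob_space.indep_sets M
       (\<lambda>s. case s of
              Coin k \<Rightarrow> sets (vimage_algebra (space M) (c k) (count_space UNIV))
            | Sample i j k \<Rightarrow> sets (vimage_algebra (space M) (\<xi> i j k) (D i))
            | Seed i k \<Rightarrow> sets (vimage_algebra (space M) (r i k) R))
       (range Coin \<union> {Sample i j k |i j k. i \<in> {1..n} \<and> j \<in> I i k \<union> I' i k} \<union>
        {Seed i k |i k. i \<in> {1..n}})"

text \<open>One run of VR-MARINA (online case). For worker \<open>i\<close>: \<open>gl i k\<close> is \<open>g\<^sub>i\<^sup>k\<close>, \<open>dt i k\<close> is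
  \<open>\<Delta>\<close>-tilde, and \<open>m i k\<close> is the vector that the worker sends to the server in order to communicate
  \<open>gl i k\<close> (the server already knows \<open>g\<^sup>k\<close>, so in a quantized round only the quantized
  difference is sent).\<close>

definition vr_marina_run ::
    "'w set \<Rightarrow> ('s \<Rightarrow> real ^ 'd \<Rightarrow> real) \<Rightarrow> ('r \<Rightarrow> real ^ 'd \<Rightarrow> real ^ 'd::finite) \<Rightarrow> nat \<Rightarrow> real \<Rightarrow>
     (nat \<Rightarrow> nat \<Rightarrow> nat set) \<Rightarrow> (nat \<Rightarrow> nat \<Rightarrow> nat set) \<Rightarrow> real ^ 'd \<Rightarrow>
     (nat \<Rightarrow> 'w \<Rightarrow> bool) \<Rightarrow> (nat \<Rightarrow> nat \<Rightarrow> nat \<Rightarrow> 'w \<Rightarrow> 's) \<Rightarrow> (nat \<Rightarrow> nat \<Rightarrow> 'w \<Rightarrow> 'r) \<Rightarrow>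
     (nat \<Rightarrow> 'w \<Rightarrow> real ^ 'd) \<Rightarrow> (nat \<Rightarrow> 'w \<Rightarrow> real ^ 'd) \<Rightarrow> (nat \<Rightarrow> nat \<Rightarrow> 'w \<Rightarrow> real ^ 'd) \<Rightarrow>
     (nat \<Rightarrow> nat \<Rightarrow> 'w \<Rightarrow> real ^ 'd) \<Rightarrow> (nat \<Rightarrow> nat \<Rightarrow> 'w \<Rightarrow> real ^ 'd) \<Rightarrow> bool" where
  "vr_marina_run \<Omega> F Q n \<gamma> I I' x0 c \<xi> r x g gl dt m \<longleftrightarrow>
     (\<forall>w\<in>\<Omega>.
        x 0 w = x0 \<and>
        (\<forall>k. x (Suc k) w = x k w - \<gamma> *\<^sub>R g k w) \<and>
        (\<forall>k. g k w = (1 / real n) *\<^sub>R (\<Sum>i=1..n. gl i k w)) \<and>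
        (\<forall>i\<in>{1..n}.
           m i 0 w = minibatch_grad F (I i 0) (\<lambda>j. \<xi> i j 0 w) x0 \<and>
           gl i 0 w = m i 0 w \<and>
           (\<forall>k.
              dt i k w = (1 / real (card (I' i (Suc k)))) *\<^sub>R
                (\<Sum>j\<in>I' i (Suc k). grad (F (\<xi> i j (Suc k) w)) (x (Suc k) w)
                                - grad (F (\<xi> i j (Suc k) w)) (x k w)) \<and>
              m i (Suc k) w =
                (if c k w then minibatch_grad F (I i (Suc k)) (\<lambda>j. \<xi> i j (Suc k) w) (x (Suc k) w)
                 else Q (r i k w) (dt i k w)) \<and>
              gl i (Suc k) w = (if c k w then m i (Suc k) w else g k w + m i (Suc k) w))))"

text \<open>A sample used in a quantized round costs two calls: its gradient is taken at \<open>x\<^sup>k\<^sup>+\<^sup>1\<close> and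
  at \<open>x\<^sup>k\<close>.\<close>

definition oracle_calls ::
    "(nat \<Rightarrow> nat \<Rightarrow> nat set) \<Rightarrow> (nat \<Rightarrow> nat \<Rightarrow> nat set) \<Rightarrow> (nat \<Rightarrow> 'w \<Rightarrow> bool) \<Rightarrow> nat \<Rightarrow> nat \<Rightarrow> 'w \<Rightarrow> nat" where
  "oracle_calls I I' c i K w =
     card (I i 0) + (\<Sum>k<K. if c k w then card (I i (Suc k)) else 2 * card (I' i (Suc k)))"

definition sent_nonzeros :: "(nat \<Rightarrow> nat \<Rightarrow> 'w \<Rightarrow> real ^ 'd::finite) \<Rightarrow> nat \<Rightarrow> nat \<Rightarrow> 'w \<Rightarrow> nat" where
  "sent_nonzeros m i K w = (\<Sum>k\<le>K. nnz (m i k w))"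

definition two_point_sigma ::
    "'w measure \<Rightarrow> (nat \<Rightarrow> 'w \<Rightarrow> real ^ 'd::finite) \<Rightarrow> nat \<Rightarrow> 'w measure" where
  "two_point_sigma M x k =
     vimage_algebra (space M) (\<lambda>w. (x k w, x (Suc k) w)) (borel \<Otimes>\<^sub>M borel)"

definition average_smooth ::
    "'w measure \<Rightarrow> (nat \<Rightarrow> 'w \<Rightarrow> real ^ 'd::finite) \<Rightarrow> (real ^ 'd \<Rightarrow> real) \<Rightarrow> (nat \<Rightarrow> 'w \<Rightarrow> real ^ 'd) \<Rightarrow>
     nat \<Rightarrow> real \<Rightarrow> bool" where
  "average_smooth M x h d b' \<L> \<longleftrightarrow>
     (\<forall>k. let \<Delta> = (\<lambda>w. grad h (x (Suc k) w) - grad h (x k w)) in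
        (\<forall>l. AE w in M. real_cond_exp M (two_point_sigma M x k) (\<lambda>w. d k w $ l) w = \<Delta> w $ l) \<and>
        (AE w in M. nn_cond_exp M (two_point_sigma M x k) (\<lambda>w. ennreal ((norm (d k w - \<Delta> w))\<^sup>2)) w
            \<le> ennreal (\<L>\<^sup>2 / real b' * (norm (x (Suc k) w - x k w))\<^sup>2)))"

text \<open>The factor hidden in the \<open>O\<close> symbols. It depends only on the upper constant \<open>c2\<close> of
  \<open>b = \<Theta>(\<sigma>\<^sup>2/(n\<mu>\<epsilon>))\<close>, on how close (\<open>\<theta>\<close>) the stepsize is to its upper bound, and on the lower
  bound \<open>\<rho>\<close> on \<open>\<Delta>\<^sub>0/\<epsilon>\<close> (the logarithm \<open>ln (\<Delta>\<^sub>0/\<epsilon>)\<close> vanishes at \<open>\<Delta>\<^sub>0 = \<epsilon>\<close>). It is given in closed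
  form because an existentially quantified constant in a theorem about \<open>real ^ 'd\<close> could depend
  on the type \<open>'d\<close>, that is, on the dimension.\<close>

definition hidden_factor :: "real \<Rightarrow> real \<Rightarrow> real \<Rightarrow> real" where
  "hidden_factor c2 \<theta> \<rho> = 20 * (1 + c2) * (1 + 1 / ln \<rho>) / \<theta>"

end

theory Submission
  imports Defs
begin

text \<open>Let \<open>e\<^sub>k = g\<^sup>k - \<nabla>f(x\<^sup>k)\<close>. Given the past, a quantized round adds to \<open>e\<^sub>k\<close> the sampling noise of
  \<open>\<Delta>\<close>-tilde and the quantization noise of the workers, all centred and pairwise orthogonal, while a round
  with \<open>c\<^sub>k = 1\<close> replaces \<open>e\<^sub>k\<close> by minibatch noise. Hence
  \<open>E|e\<^sub>k\<^sub>+\<^sub>1|\<^sup>2 \<le> (1 - p) (E|e\<^sub>k|\<^sup>2 + B E|x\<^sup>k\<^sup>+\<^sup>1 - x\<^sup>k|\<^sup>2) + p \<sigma>\<^sup>2/(n b)\<close>.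
  With the descent inequality under the Polyak-Lojasiewicz condition, the Lyapunov function
  \<open>E[f(x\<^sup>k) - f(x\<^sup>*)] + (\<gamma>/p) E|e\<^sub>k|\<^sup>2\<close> contracts by the factor \<open>1 - \<gamma>\<mu>\<close> up to \<open>\<gamma>\<sigma>\<^sup>2/(n b)\<close>, whose
  accumulated effect \<open>\<sigma>\<^sup>2/(n b \<mu>)\<close> is at most \<open>\<epsilon>/3\<close>. It remains to run \<open>O(ln (\<Delta>\<^sub>0/\<epsilon>)/(\<gamma>\<mu>))\<close> iterations
  and to bound \<open>1/(\<gamma>\<mu>)\<close>.\<close>

section \<open>Square integrable random vectors\<close>

text \<open>The hypothesis \<open>average_smooth\<close> conditions on the two iterates only and
  treats each worker separately: it controls the size of one worker's sampling noise, but not the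
  correlation between workers. Orthogonality is therefore derived from the independence of the
  elementary sources, by means of the sigma-algebras \<open>info S\<close> generated by sets S of
  sources: a term whose average over its own fresh source is 0 is orthogonal to everything that the
  remaining sources determine. A conditional expectation is handled only where
  \<open>average_smooth\<close> is read off.

  The Bochner integral of a non-integrable function is 0, so square integrability has to be
  propagated along the iterates before second moments and inner products mean what they should. This
  is why new second moments are first estimated as nonnegative integrals.

  Beside the noise floor, \<open>2 / 3 * \<epsilon>\<close> is left for the contracted initial value
  of the Lyapunov function, which consists of \<open>\<Delta>0\<close> and of an initial error of at
  most \<open>\<epsilon> / 6\<close>.\<close>

definition square_integrable :: "'w measure \<Rightarrow> ('w \<Rightarrow> 'a::euclidean_space) \<Rightarrow> bool" where
  "square_integrable M U \<longleftrightarrow> U \<in> borel_measurable M \<and> integrable M (\<lambda>w. (norm (U w))\<^sup>2)"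

definition mean_sq :: "'w measure \<Rightarrow> ('w \<Rightarrow> 'a::euclidean_space) \<Rightarrow> real" where
  "mean_sq M U = (LINT w|M. (norm (U w))\<^sup>2)"

text \<open>By itself this also holds when the inner product is not integrable, because the integral
  is then 0 by convention; it has its meaning only together with square integrability of both
  vectors.\<close>

definition orth :: "'w measure \<Rightarrow> ('w \<Rightarrow> 'a::euclidean_space) \<Rightarrow> ('w \<Rightarrow> 'a) \<Rightarrow> bool" where
  "orth M U V \<longleftrightarrow> (LINT w|M. U w \<bullet> V w) = 0"

lemma mean_sq_nonneg: "0 \<le> mean_sq M U"
  by (simp add: mean_sq_def)

lemma square_integrableD [dest]:
  assumes "square_integrable M U"
  shows "U \<in> borel_measurable M" "integrable M (\<lambda>w. (norm (U w))\<^sup>2)"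
  using assms by (auto simp: square_integrable_def)

text \<open>No sign of \<open>a\<close> is required, since Lipschitz constants \<open>Li i\<close>
  of unspecified sign are passed for it. Squaring is legitimate because 0 \<le>
  \<open>norm (U w)\<close> \<le> \<open>a * norm (V w)\<close>.\<close>

lemma square_integrable_norm_le:
  assumes "square_integrable M V" "U \<in> borel_measurable M"
    and "\<And>w. w \<in> space M \<Longrightarrow> norm (U w) \<le> a * norm (V w)"
  shows "square_integrable M U"
  unfolding square_integrable_def
proof (intro conjI)
  show "integrable M (\<lambda>w. (norm (U w))\<^sup>2)"
  proof (rule Bochner_Integration.integrable_bound)
    show "integrable M (\<lambda>w. a\<^sup>2 * (norm (V w))\<^sup>2)"
      using assms(1) by auto
    show "AE w in M. norm ((norm (U w))\<^sup>2) \<le> norm (a\<^sup>2 * (norm (V w))\<^sup>2)"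
    proof (rule AE_I2)
      fix w assume "w \<in> space M"
      then have "(norm (U w))\<^sup>2 \<le> (a * norm (V w))\<^sup>2"
        by (intro power_mono assms(3)) auto
      then show "norm ((norm (U w))\<^sup>2) \<le> norm (a\<^sup>2 * (norm (V w))\<^sup>2)"
        by (simp add: power_mult_distrib)
    qed
  qed (use assms(2) in measurable)
qed (fact assms(2))

lemma mean_sq_le:
  assumes "square_integrable M V" "square_integrable M U"
    and "\<And>w. w \<in> space M \<Longrightarrow> norm (U w) \<le> a * norm (V w)"
  shows "mean_sq M U \<le> a\<^sup>2 * mean_sq M V"
proof -
  have "mean_sq M U \<le> (LINT w|M. a\<^sup>2 * (norm (V w))\<^sup>2)"
    unfolding mean_sq_def
  proof (rule integral_mono)
    fix w assume "w \<in> space M"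
    then have "(norm (U w))\<^sup>2 \<le> (a * norm (V w))\<^sup>2"
      by (intro power_mono assms(3)) auto
    then show "(norm (U w))\<^sup>2 \<le> a\<^sup>2 * (norm (V w))\<^sup>2"
      by (simp add: power_mult_distrib)
  qed (use assms in auto)
  then show ?thesis
    by (simp add: mean_sq_def)
qed

lemma square_integrable_scaleR:
  assumes "square_integrable M U"
  shows "square_integrable M (\<lambda>w. a *\<^sub>R U w)"
  using assms by (intro square_integrable_norm_le[OF assms, of _ "\<bar>a\<bar>"]) auto

lemma square_integrable_add:
  fixes U V :: "'w \<Rightarrow> 'a::euclidean_space"
  assumes "square_integrable M U" "square_integrable M V"
  shows "square_integrable M (\<lambda>w. U w + V w)"
  unfolding square_integrable_def
proof (intro conjI)
  have [measurable]: "U \<in> borel_measurable M" "V \<in> borel_measurable M"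
    using assms by auto
  show "(\<lambda>w. U w + V w) \<in> borel_measurable M"
    by measurable
  show "integrable M (\<lambda>w. (norm (U w + V w))\<^sup>2)"
  proof (rule Bochner_Integration.integrable_bound)
    show "integrable M (\<lambda>w. 2 * (norm (U w))\<^sup>2 + 2 * (norm (V w))\<^sup>2)"
      using square_integrableD(2)[OF assms(1)] square_integrableD(2)[OF assms(2)] by simp
    have "(norm (u + v))\<^sup>2 \<le> 2 * (norm u)\<^sup>2 + 2 * (norm v)\<^sup>2" for u v :: 'a
    proof -
      have "(norm (u + v))\<^sup>2 \<le> (norm u + norm v)\<^sup>2"
        by (intro power_mono norm_triangle_ineq) auto
      moreover have "0 \<le> (norm u - norm v)\<^sup>2"
        by simp
      ultimately show ?thesis
        unfolding power2_sum power2_diff by linarith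
    qed
    then show "AE w in M. norm ((norm (U w + V w))\<^sup>2) \<le> norm (2 * (norm (U w))\<^sup>2 + 2 * (norm (V w))\<^sup>2)"
      by (intro AE_I2) simp
  qed measurable
qed

lemma square_integrable_diff:
  assumes "square_integrable M U" "square_integrable M V"
  shows "square_integrable M (\<lambda>w. U w - V w)"
  using square_integrable_add[OF assms(1) square_integrable_scaleR[OF assms(2), of "-1"]] by simp

lemma square_integrable_sum:
  assumes "\<And>t. t \<in> T \<Longrightarrow> square_integrable M (V t)"
  shows "square_integrable M (\<lambda>w. \<Sum>t\<in>T. V t w)"
  using assms
proof (induction T rule: infinite_finite_induct)
  case (insert s T)
  then show ?case
    by (simp add: square_integrable_add)
qed (simp_all add: square_integrable_def)

lemma square_integrable_cong:
  assumes "\<And>w. w \<in> space M \<Longrightarrow> U w = V w"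
  shows "square_integrable M U \<longleftrightarrow> square_integrable M V"
proof -
  have "U \<in> borel_measurable M \<longleftrightarrow> V \<in> borel_measurable M"
    using assms by (intro measurable_cong) auto
  moreover have "integrable M (\<lambda>w. (norm (U w))\<^sup>2) \<longleftrightarrow> integrable M (\<lambda>w. (norm (V w))\<^sup>2)"
    using assms by (intro Bochner_Integration.integrable_cong) auto
  ultimately show ?thesis
    by (simp add: square_integrable_def)
qed

lemma mean_sq_cong:
  assumes "\<And>w. w \<in> space M \<Longrightarrow> U w = V w"
  shows "mean_sq M U = mean_sq M V"
  unfolding mean_sq_def using assms by (intro Bochner_Integration.integral_cong) auto

text \<open>Polarisation writes the inner product as a combination of three integrable
  squares.\<close>

lemma integrable_inner:
  fixes U V :: "'w \<Rightarrow> 'a::euclidean_space"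
  assumes "square_integrable M U" "square_integrable M V"
  shows "integrable M (\<lambda>w. U w \<bullet> V w)"
proof -
  have "integrable M (\<lambda>w. ((norm (U w + V w))\<^sup>2 - (norm (U w))\<^sup>2 - (norm (V w))\<^sup>2) / 2)"
    using assms square_integrable_add[OF assms]
    by (intro integrable_divide_zero Bochner_Integration.integrable_diff square_integrableD(2))
  moreover have "((norm (u + v))\<^sup>2 - (norm u)\<^sup>2 - (norm v)\<^sup>2) / 2 = u \<bullet> v" for u v :: 'a
    by (simp add: power2_norm_eq_inner inner_add_left inner_add_right inner_commute)
  ultimately show ?thesis
    by simp
qed

lemma integral_ennreal_mean_sq:
  assumes "square_integrable M U"
  shows "(\<integral>\<^sup>+w. ennreal ((norm (U w))\<^sup>2) \<partial>M) = ennreal (mean_sq M U)"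
  unfolding mean_sq_def using assms by (intro nn_integral_eq_integral) auto

text \<open>Entry point for second moments: over independent sources they are computed by Tonelli,
  which presupposes no integrability, and a finite result then yields it. The condition
  \<open>0 \<le> a\<close> is there because \<open>ennreal\<close> sends negative numbers to
  0.\<close>

lemma square_integrableI_nn:
  assumes "U \<in> borel_measurable M" "(\<integral>\<^sup>+w. ennreal ((norm (U w))\<^sup>2) \<partial>M) \<le> ennreal a"
  shows "square_integrable M U" "0 \<le> a \<Longrightarrow> mean_sq M U \<le> a"
proof -
  show *: "square_integrable M U"
    unfolding square_integrable_def
  proof (intro conjI)
    show "integrable M (\<lambda>w. (norm (U w))\<^sup>2)"
      unfolding integrable_iff_bounded
    proof
      show "(\<lambda>w. (norm (U w))\<^sup>2) \<in> borel_measurable M"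
        using assms(1) by measurable
      show "(\<integral>\<^sup>+w. ennreal (norm ((norm (U w))\<^sup>2)) \<partial>M) < \<infinity>"
        using le_less_trans[OF assms(2)] by simp
    qed
  qed (fact assms(1))
  show "mean_sq M U \<le> a" if "0 \<le> a"
    using assms(2) that unfolding integral_ennreal_mean_sq[OF *] by simp
qed

section \<open>Orthogonality and the Pythagorean identity\<close>

lemma orth_scaleR:
  assumes "orth M U V"
  shows "orth M U (\<lambda>w. a *\<^sub>R V w)"
  using assms by (simp add: orth_def)

lemma orth_add:
  assumes "square_integrable M U" "square_integrable M V" "square_integrable M W"
    and "orth M U V" "orth M U W"
  shows "orth M U (\<lambda>w. V w + W w)"
  using assms integrable_inner[OF assms(1,2)] integrable_inner[OF assms(1,3)]
  by (simp add: orth_def inner_add_right)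

lemma orth_diff:
  assumes "square_integrable M U" "square_integrable M V" "square_integrable M W"
    and "orth M U V" "orth M U W"
  shows "orth M U (\<lambda>w. V w - W w)"
  using assms integrable_inner[OF assms(1,2)] integrable_inner[OF assms(1,3)]
  by (simp add: orth_def inner_diff_right)

lemma orth_sum:
  assumes "square_integrable M U" "\<And>t. t \<in> T \<Longrightarrow> square_integrable M (V t)"
    and "\<And>t. t \<in> T \<Longrightarrow> orth M U (V t)"
  shows "orth M U (\<lambda>w. \<Sum>t\<in>T. V t w)"
  using assms integrable_inner[OF assms(1,2)]
  by (simp add: orth_def inner_sum_right)

lemma mean_sq_scaleR: "mean_sq M (\<lambda>w. a *\<^sub>R U w) = a\<^sup>2 * mean_sq M U"
  by (simp add: mean_sq_def power_mult_distrib)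

lemma mean_sq_add_orth:
  assumes "square_integrable M U" "square_integrable M V" "orth M U V"
  shows "mean_sq M (\<lambda>w. U w + V w) = mean_sq M U + mean_sq M V"
proof -
  have "mean_sq M (\<lambda>w. U w + V w)
      = (LINT w|M. (norm (U w))\<^sup>2 + (norm (V w))\<^sup>2 + 2 * (U w \<bullet> V w))"
    unfolding mean_sq_def
    by (simp add: power2_norm_eq_inner inner_add_left inner_add_right inner_commute algebra_simps)
  also have "\<dots> = mean_sq M U + mean_sq M V + 2 * (LINT w|M. U w \<bullet> V w)"
    unfolding mean_sq_def
    using square_integrableD(2)[OF assms(1)] square_integrableD(2)[OF assms(2)]
      integrable_inner[OF assms(1,2)] by simp
  finally show ?thesis
    using assms(3) by (simp add: orth_def)
qed

lemma mean_sq_sum_orth: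
  assumes "finite T" "\<And>t. t \<in> T \<Longrightarrow> square_integrable M (V t)"
    and "\<And>s t. s \<in> T \<Longrightarrow> t \<in> T \<Longrightarrow> s \<noteq> t \<Longrightarrow> orth M (V s) (V t)"
  shows "mean_sq M (\<lambda>w. \<Sum>t\<in>T. V t w) = (\<Sum>t\<in>T. mean_sq M (V t))"
  using assms
proof (induction T)
  case empty
  then show ?case by (simp add: mean_sq_def)
next
  case (insert s T)
  have "mean_sq M (\<lambda>w. V s w + (\<Sum>t\<in>T. V t w)) = mean_sq M (V s) + mean_sq M (\<lambda>w. \<Sum>t\<in>T. V t w)"
  proof (rule mean_sq_add_orth)
    show "orth M (V s) (\<lambda>w. \<Sum>t\<in>T. V t w)"
      using insert.hyps insert.prems by (intro orth_sum) (blast intro: insertI1 insertI2)+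
  qed (use insert in \<open>auto intro!: square_integrable_sum\<close>)
  with insert show ?case
    by simp
qed

section \<open>Independent sources of randomness\<close>

text \<open>Coins, samples and seeds take values in different types, so a source is represented by
  the family of events that it generates.\<close>

locale independent_sources = prob_space M for M :: "'w measure" +
  fixes E :: "'i \<Rightarrow> 'w set set" and J :: "'i set"
  assumes indep_E: "indep_sets E J"
    and Int_stable_E: "\<And>s. s \<in> J \<Longrightarrow> Int_stable (E s)"
begin

text \<open>What can be known from the sources in S. Intersecting with \<open>J\<close> allows S to
  be described loosely, for instance as a complement or as all samples of a batch number, including
  indices that are never drawn.\<close>

definition info :: "'i set \<Rightarrow> 'w measure" where
  "info S = sigma (space M) (\<Union>s\<in>S \<inter> J. E s)"

lemma E_events: "s \<in> J \<Longrightarrow> E s \<subseteq> events"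
  using indep_E by (auto simp: indep_sets_def)

lemma E_Pow: "(\<Union>s\<in>S \<inter> J. E s) \<subseteq> Pow (space M)"
  using E_events sets.space_closed by blast

lemma space_info [simp]: "space (info S) = space M"
  unfolding info_def by (simp add: space_measure_of_conv)

lemma sets_info: "sets (info S) = sigma_sets (space M) (\<Union>s\<in>S \<inter> J. E s)"
  unfolding info_def using E_Pow by (simp add: sets_measure_of)

lemma sets_info_mono: "S \<subseteq> T \<Longrightarrow> sets (info S) \<subseteq> sets (info T)"
  unfolding sets_info by (intro sigma_sets_mono') auto

lemma sets_info_events: "sets (info S) \<subseteq> events"
  unfolding sets_info using E_events by (intro sets.sigma_sets_subset) auto

lemma measurable_info_mono:
  assumes "U \<in> measurable (info S) N" "S \<subseteq> T"
  shows "U \<in> measurable (info T) N"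
  using measurable_sets[OF assms(1)] measurable_space[OF assms(1)] sets_info_mono[OF assms(2)]
  by (intro measurableI) (simp_all, blast)

lemma measurable_info:
  assumes "U \<in> measurable (info S) N"
  shows "U \<in> measurable M N"
  using measurable_sets[OF assms] measurable_space[OF assms] sets_info_events[of S]
  by (intro measurableI) (simp_all, blast)

lemma source_measurable_info:
  assumes "s \<in> J" "s \<in> S" "E s = sets (vimage_algebra (space M) Y N)" "Y \<in> space M \<rightarrow> space N"
  shows "Y \<in> measurable (info S) N"
proof (rule measurableI)
  fix A assume "A \<in> sets N"
  then have "Y -` A \<inter> space M \<in> E s"
    unfolding assms(3) by (rule in_vimage_algebra)
  with assms(1,2) show "Y -` A \<inter> space (info S) \<in> sets (info S)"
    unfolding sets_info by auto
qed (use assms in auto)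

text \<open>Independent pi-systems can be grouped into disjoint blocks, and the sigma-algebras
  generated by the blocks stay independent.\<close>

lemma indep_set_info:
  assumes "S \<inter> T = {}"
  shows "indep_set (sets (info S)) (sets (info T))"
proof -
  define G where "G = (\<lambda>a. if a then S \<inter> J else T \<inter> J)"
  have "indep_sets (\<lambda>a. sigma_sets (space M) (\<Union>s\<in>G a. E s)) UNIV"
  proof (rule indep_sets_collect_sigma)
    show "indep_sets E (\<Union>a\<in>UNIV. G a)"
      using indep_E by (rule indep_sets_mono_index[rotated]) (auto simp: G_def split: if_splits)
    show "disjoint_family_on G UNIV"
      using assms by (auto simp: G_def disjoint_family_on_def)
  qed (use Int_stable_E in \<open>auto simp: G_def split: if_splits\<close>)
  moreover have "(\<lambda>a. sigma_sets (space M) (\<Union>s\<in>G a. E s)) = case_bool (sets (info S)) (sets (info T))"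
    by (auto simp: fun_eq_iff G_def sets_info split: bool.split)
  ultimately show ?thesis
    unfolding indep_set_def by simp
qed

lemma indep_var_info:
  assumes U: "U \<in> measurable (info S) N1" and V: "V \<in> measurable (info T) N2" and ST: "S \<inter> T = {}"
  shows "indep_var N1 U N2 V"
proof -
  have "{ U -` A \<inter> space M | A. A \<in> sets N1} \<subseteq> sets (info S)"
       "{ V -` A \<inter> space M | A. A \<in> sets N2} \<subseteq> sets (info T)"
    using measurable_sets[OF U] measurable_sets[OF V] by auto
  then have sub: "sigma_sets (space M) { U -` A \<inter> space M | A. A \<in> sets N1} \<subseteq> sets (info S)"
       "sigma_sets (space M) { V -` A \<inter> space M | A. A \<in> sets N2} \<subseteq> sets (info T)"
    using sets.sigma_sets_subset[of _ "info S"] sets.sigma_sets_subset[of _ "info T"]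
    by simp_all
  have "indep_set (sigma_sets (space M) { U -` A \<inter> space M | A. A \<in> sets N1})
      (sigma_sets (space M) { V -` A \<inter> space M | A. A \<in> sets N2})"
    using indep_set_info[OF ST] unfolding indep_set_def
    by (rule indep_sets_mono_sets) (use sub in \<open>auto split: bool.split\<close>)
  then show ?thesis
    unfolding indep_var_eq by (intro conjI measurable_info[OF U] measurable_info[OF V])
qed

text \<open>\<open>U\<close> and \<open>V\<close> may have different value types. The joint law is
  identified on rectangles, where independence of the two sigma-algebras factorises the
  probability.\<close>

lemma distr_Pair_info:
  assumes U: "U \<in> measurable (info S) N1" and V: "V \<in> measurable (info T) N2" and ST: "S \<inter> T = {}"
  shows "distr M N1 U \<Otimes>\<^sub>M distr M N2 V = distr M (N1 \<Otimes>\<^sub>M N2) (\<lambda>w. (U w, V w))"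
proof (rule pair_measure_eqI)
  note [measurable] = measurable_info[OF U] measurable_info[OF V]
  interpret DU: prob_space "distr M N1 U"
    by (rule prob_space_distr) simp
  interpret DV: prob_space "distr M N2 V"
    by (rule prob_space_distr) simp
  show "sigma_finite_measure (distr M N1 U)" "sigma_finite_measure (distr M N2 V)"
    by unfold_locales
  fix A B assume "A \<in> sets (distr M N1 U)" "B \<in> sets (distr M N2 V)"
  then have [measurable]: "A \<in> sets N1" "B \<in> sets N2"
    by simp_all
  have "prob ((U -` A \<inter> space M) \<inter> (V -` B \<inter> space M)) = prob (U -` A \<inter> space M) * prob (V -` B \<inter> space M)"
  proof (rule indep_setD[OF indep_set_info[OF ST]])
    show "U -` A \<inter> space M \<in> sets (info S)" "V -` B \<inter> space M \<in> sets (info T)"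
      using measurable_sets[OF U, of A] measurable_sets[OF V, of B] by simp_all
  qed
  moreover have "(\<lambda>w. (U w, V w)) -` (A \<times> B) \<inter> space M = (U -` A \<inter> space M) \<inter> (V -` B \<inter> space M)"
    by auto
  ultimately show "emeasure (distr M N1 U) A * emeasure (distr M N2 V) B
      = emeasure (distr M (N1 \<Otimes>\<^sub>M N2) (\<lambda>w. (U w, V w))) (A \<times> B)"
    by (simp add: emeasure_distr emeasure_eq_measure ennreal_mult)
qed simp

text \<open>Freezing: since \<open>Y\<close> is independent of \<open>U\<close>, it can be
  integrated out under its law while \<open>U\<close> is held fixed. This transfers hypotheses about
  fixed points to random ones.\<close>

lemma nn_integral_fresh:
  assumes U: "U \<in> measurable (info S) N1" and Y: "Y \<in> measurable (info T) N2" and ST: "S \<inter> T = {}"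
    and law: "distr M N2 Y = N2" and h: "h \<in> borel_measurable (N1 \<Otimes>\<^sub>M N2)"
  shows "(\<integral>\<^sup>+w. h (U w, Y w) \<partial>M) = (\<integral>\<^sup>+w. (\<integral>\<^sup>+y. h (U w, y) \<partial>N2) \<partial>M)"
proof -
  note [measurable] = measurable_info[OF U] measurable_info[OF Y] h
  interpret N2: prob_space N2
    by (rule prob_space_distr[OF measurable_info[OF Y], unfolded law])
  have eq: "distr M N1 U \<Otimes>\<^sub>M N2 = distr M (N1 \<Otimes>\<^sub>M N2) (\<lambda>w. (U w, Y w))"
    using distr_Pair_info[OF U Y ST] unfolding law .
  have "(\<integral>\<^sup>+w. h (U w, Y w) \<partial>M) = (\<integral>\<^sup>+z. h z \<partial>(distr M N1 U \<Otimes>\<^sub>M N2))"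
    unfolding eq by (subst nn_integral_distr) auto
  also have "\<dots> = (\<integral>\<^sup>+u. (\<integral>\<^sup>+y. h (u, y) \<partial>N2) \<partial>(distr M N1 U))"
    by (rule N2.nn_integral_fst[symmetric]) (simp add: cong: measurable_cong_sets)
  also have "\<dots> = (\<integral>\<^sup>+w. (\<integral>\<^sup>+y. h (U w, y) \<partial>N2) \<partial>M)"
    by (rule nn_integral_distr) (auto intro!: N2.borel_measurable_nn_integral_fst)
  finally show ?thesis .
qed

text \<open>Signed counterpart of the freezing argument. Fubini applies because the inner product of
  two square integrable vectors is integrable; the inner integral over \<open>Y\<close> vanishes for
  every frozen value.\<close>

lemma orth_fresh:
  fixes V :: "'w \<Rightarrow> 'e::euclidean_space"
  assumes V: "V \<in> measurable (info S) borel" "square_integrable M V"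
    and X: "X \<in> measurable (info S) N1" and Y: "Y \<in> measurable (info T) N2" and ST: "S \<inter> T = {}"
    and law: "distr M N2 Y = N2" and h[measurable]: "h \<in> borel_measurable (N1 \<Otimes>\<^sub>M N2)"
    and sq: "square_integrable M (\<lambda>w. h (X w, Y w))"
    and mean: "\<And>z. z \<in> space N1 \<Longrightarrow> integrable N2 (\<lambda>y. h (z, y)) \<and> (LINT y|N2. h (z, y)) = 0"
  shows "orth M V (\<lambda>w. h (X w, Y w))"
proof -
  \<comment> \<open>\<open>V\<close> and \<open>X\<close> may depend on each other, so they are
    frozen as a pair.\<close>
  define U where "U = (\<lambda>w. (V w, X w))"
  have U: "U \<in> measurable (info S) (borel \<Otimes>\<^sub>M N1)"
    unfolding U_def using V(1) X by measurable
  note [measurable] = measurable_info[OF U] measurable_info[OF Y]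
  interpret N2: prob_space N2
    by (rule prob_space_distr[OF measurable_info[OF Y], unfolded law])
  interpret DU: prob_space "distr M (borel \<Otimes>\<^sub>M N1) U"
    by (rule prob_space_distr) simp
  interpret P: pair_sigma_finite "distr M (borel \<Otimes>\<^sub>M N1) U" N2 ..
  define H where "H = (\<lambda>(u, y). fst u \<bullet> h (snd u, y))"
  have H[measurable]: "H \<in> borel_measurable ((borel \<Otimes>\<^sub>M N1) \<Otimes>\<^sub>M N2)"
    unfolding H_def by measurable
  have eq: "distr M (borel \<Otimes>\<^sub>M N1) U \<Otimes>\<^sub>M N2
      = distr M ((borel \<Otimes>\<^sub>M N1) \<Otimes>\<^sub>M N2) (\<lambda>w. (U w, Y w))"
    using distr_Pair_info[OF U Y ST] unfolding law .
  have "integrable M (\<lambda>w. H (U w, Y w))"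
    using integrable_inner[OF V(2) sq] by (simp add: H_def U_def)
  then have int: "integrable (distr M (borel \<Otimes>\<^sub>M N1) U \<Otimes>\<^sub>M N2) H"
    unfolding eq by (subst integrable_distr_eq) auto
  have zero: "(LINT y|N2. H (u, y)) = 0" if "u \<in> space (borel \<Otimes>\<^sub>M N1)" for u
  proof -
    have "integrable N2 (\<lambda>y. h (snd u, y)) \<and> (LINT y|N2. h (snd u, y)) = 0"
      using that by (intro mean) (auto simp: space_pair_measure)
    then show ?thesis
      by (simp add: H_def)
  qed
  have "(LINT w|M. V w \<bullet> h (X w, Y w)) = (LINT w|M. H (U w, Y w))"
    by (simp add: H_def U_def)
  also have "\<dots> = (LINT z|(distr M (borel \<Otimes>\<^sub>M N1) U \<Otimes>\<^sub>M N2). H z)"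
    unfolding eq by (subst integral_distr) auto
  also have "\<dots> = (LINT u|distr M (borel \<Otimes>\<^sub>M N1) U. (LINT y|N2. H (u, y)))"
    using int by (rule P.integral_fst'[symmetric])
  also have "\<dots> = (LINT u|distr M (borel \<Otimes>\<^sub>M N1) U. 0)"
    using zero by (intro Bochner_Integration.integral_cong) auto
  finally show ?thesis
    by (simp add: orth_def)
qed

text \<open>The indicator of a fresh coin and \<open>Z\<close> are independent integrable variables,
  so the expectation of their product factorises; the complementary branch follows by
  subtraction.\<close>

lemma integral_coin_mult:
  fixes Z :: "'w \<Rightarrow> real"
  assumes c: "c \<in> measurable (info T) (count_space UNIV)"
    and law: "distr M (count_space UNIV) c = measure_pmf (bernoulli_pmf p)" and p: "0 \<le> p" "p \<le> 1"
    and Z: "Z \<in> measurable (info S) borel" "integrable M Z" and ST: "S \<inter> T = {}"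
  shows "integrable M (\<lambda>w. if c w then Z w else 0)"
    and "(LINT w|M. (if c w then Z w else 0)) = p * (LINT w|M. Z w)"
    and "integrable M (\<lambda>w. if c w then 0 else Z w)"
    and "(LINT w|M. (if c w then 0 else Z w)) = (1 - p) * (LINT w|M. Z w)"
proof -
  note [measurable] = measurable_info[OF c]
  define B where "B = (\<lambda>w. of_bool (c w) :: real)"
  have B: "B \<in> measurable (info T) borel"
    unfolding B_def by (rule measurable_compose[OF c]) simp
  have intB: "integrable M B"
    unfolding B_def by (rule integrable_const_bound[where B = 1]) auto
  have "(LINT w|M. B w) = (LINT a|distr M (count_space UNIV) c. of_bool a)"
    unfolding B_def by (subst integral_distr) auto
  also have "\<dots> = p"
    unfolding law using p by simp
  finally have EB: "(LINT w|M. B w) = p" .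
  have ind: "indep_var borel B borel Z"
    by (rule indep_var_info[OF B Z(1)]) (use ST in auto)
  have "integrable M (\<lambda>w. B w * Z w)" "(LINT w|M. B w * Z w) = p * (LINT w|M. Z w)"
    using indep_var_integrable[OF ind intB Z(2)] indep_var_lebesgue_integral[OF ind intB Z(2)] EB
    by simp_all
  moreover have eq: "B w * Z w = (if c w then Z w else 0)" for w
    by (simp add: B_def)
  ultimately show 1: "integrable M (\<lambda>w. if c w then Z w else 0)"
    "(LINT w|M. (if c w then Z w else 0)) = p * (LINT w|M. Z w)"
    by simp_all
  have eq: "(if c w then 0 else Z w) = Z w - (if c w then Z w else 0)" for w
    by simp
  show "integrable M (\<lambda>w. if c w then 0 else Z w)"
    unfolding eq using 1 Z(2) by simp
  show "(LINT w|M. (if c w then 0 else Z w)) = (1 - p) * (LINT w|M. Z w)"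
    unfolding eq using 1 Z(2) by (simp add: algebra_simps)
qed

end

section \<open>Smooth functions and the descent recursion\<close>

lemma grad_eqI:
  fixes f :: "'a::euclidean_space \<Rightarrow> real"
  assumes "GDERIV f x :> v"
  shows "grad f x = v"
proof -
  have "f differentiable (at x)"
    using assms unfolding gderiv_def by (rule differentiableI)
  then have "GDERIV f x :> grad f x"
    by (rule GDERIV_grad)
  then have "(\<lambda>h. h \<bullet> grad f x) = (\<lambda>h. h \<bullet> v)"
    using assms unfolding gderiv_def by (rule has_derivative_unique)
  then show ?thesis
    by (metis vector_eq_ldot)
qed

lemma continuous_grad:
  assumes "smooth_with L f"
  shows "continuous_on UNIV (grad f)"
proof -
  \<comment> \<open>A Lipschitz constant must be nonnegative here, whereas
    \<open>smooth_with\<close> leaves the sign of \<open>L\<close> open.\<close>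
  have "(\<bar>L\<bar>)-lipschitz_on UNIV (grad f)"
  proof (rule lipschitz_onI)
    fix x y
    have "norm (grad f x - grad f y) \<le> L * norm (x - y)"
      using assms by (simp add: smooth_with_def)
    also have "\<dots> \<le> \<bar>L\<bar> * norm (x - y)"
      by (intro mult_right_mono) auto
    finally show "dist (grad f x) (grad f y) \<le> \<bar>L\<bar> * dist x y"
      by (simp add: dist_norm)
  qed simp
  then show ?thesis
    by (rule lipschitz_on_continuous_on)
qed

lemma borel_measurable_grad:
  fixes f :: "'a::euclidean_space \<Rightarrow> real"
  assumes "smooth_with L f"
  shows "grad f \<in> borel_measurable borel"
  using continuous_grad[OF assms] by (rule borel_measurable_continuous_onI)

lemma borel_measurable_smooth:
  fixes f :: "'a::euclidean_space \<Rightarrow> real"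
  assumes "smooth_with L f"
  shows "f \<in> borel_measurable borel"
proof (rule borel_measurable_continuous_onI)
  show "continuous_on UNIV f"
    using assms unfolding smooth_with_def
    by (auto intro!: differentiable_imp_continuous_on simp: differentiable_on_def differentiable_at_withinI)
qed

text \<open>\<open>\<phi>\<close> is f along the segment minus the quadratic model. Its derivative
  is nonpositive by Cauchy-Schwarz and the Lipschitz bound on the gradient, so comparing its values
  at 0 and 1 gives the claim without any integral.\<close>

lemma smooth_with_descent:
  fixes f :: "'a::euclidean_space \<Rightarrow> real"
  assumes "smooth_with L f"
  shows "f y \<le> f x + grad f x \<bullet> (y - x) + L / 2 * (norm (y - x))\<^sup>2"
proof -
  define v where "v = y - x"
  define \<phi> where "\<phi> t = f (x + t *\<^sub>R v) - t * (grad f x \<bullet> v) - t\<^sup>2 * (L / 2 * (norm v)\<^sup>2)" for t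
  have "\<phi> 1 \<le> \<phi> 0"
  proof (rule DERIV_nonpos_imp_nonincreasing[of 0 1 \<phi>])
    fix t :: real assume t: "0 \<le> t" "t \<le> 1"
    let ?g = "grad f (x + t *\<^sub>R v)"
    have "(f has_derivative (\<lambda>h. h \<bullet> ?g)) (at (x + t *\<^sub>R v))"
      using GDERIV_grad[of f] assms by (auto simp: gderiv_def smooth_with_def)
    moreover have "((\<lambda>t. x + t *\<^sub>R v) has_derivative (\<lambda>s. s *\<^sub>R v)) (at t)"
      by (auto intro!: derivative_eq_intros)
    ultimately have "((\<lambda>t. f (x + t *\<^sub>R v)) has_derivative (\<lambda>s. (s *\<^sub>R v) \<bullet> ?g)) (at t)"
      using has_derivative_compose[of "\<lambda>t. x + t *\<^sub>R v" "\<lambda>s. s *\<^sub>R v" t UNIV f "\<lambda>h. h \<bullet> ?g"] by simp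
    moreover have "(\<lambda>s. (s *\<^sub>R v) \<bullet> ?g) = (*) (?g \<bullet> v)"
      by (auto simp: inner_commute)
    ultimately have [derivative_intros]: "((\<lambda>t. f (x + t *\<^sub>R v)) has_real_derivative ?g \<bullet> v) (at t)"
      by (simp add: has_field_derivative_def)
    have "(\<phi> has_real_derivative ?g \<bullet> v - grad f x \<bullet> v - t * L * (norm v)\<^sup>2) (at t)"
      unfolding \<phi>_def by (auto intro!: derivative_eq_intros simp: algebra_simps)
    moreover have "?g \<bullet> v - grad f x \<bullet> v \<le> t * L * (norm v)\<^sup>2"
    proof -
      have "(?g - grad f x) \<bullet> v \<le> norm (?g - grad f x) * norm v"
        by (rule norm_cauchy_schwarz)
      also have "\<dots> \<le> (L * norm (x + t *\<^sub>R v - x)) * norm v"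
        using assms by (intro mult_right_mono[OF _ norm_ge_zero]) (unfold smooth_with_def, blast)
      finally show ?thesis
        using t by (simp add: inner_diff_left power2_eq_square algebra_simps)
    qed
    ultimately show "\<exists>z. (\<phi> has_real_derivative z) (at t) \<and> z \<le> 0"
      by (intro exI[of _ "?g \<bullet> v - grad f x \<bullet> v - t * L * (norm v)\<^sup>2"]) auto
  qed simp
  then show ?thesis
    by (simp add: \<phi>_def v_def)
qed

lemma grad_mean:
  fixes f :: "'a::euclidean_space \<Rightarrow> real"
  assumes "\<And>z. f z = (1 / real n) * (\<Sum>i=1..n. fi i z)"
    and "\<And>i. i \<in> {1..n} \<Longrightarrow> smooth_with (Li i) (fi i)"
  shows "f differentiable (at z)" and "grad f z = (1 / real n) *\<^sub>R (\<Sum>i=1..n. grad (fi i) z)"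
proof -
  have "(fi i has_derivative (\<lambda>h. h \<bullet> grad (fi i) z)) (at z)" if "i \<in> {1..n}" for i
    using assms(2)[OF that] GDERIV_grad[of "fi i" z] by (auto simp: smooth_with_def gderiv_def)
  then have "((\<lambda>z. (1 / real n) * (\<Sum>i=1..n. fi i z)) has_derivative
      (\<lambda>h. (1 / real n) * (\<Sum>i=1..n. h \<bullet> grad (fi i) z))) (at z)"
    by (intro has_derivative_mult_right has_derivative_sum) auto
  moreover have "f = (\<lambda>z. (1 / real n) * (\<Sum>i=1..n. fi i z))"
    using assms(1) by auto
  ultimately have *: "GDERIV f z :> (1 / real n) *\<^sub>R (\<Sum>i=1..n. grad (fi i) z)"
    by (simp add: gderiv_def inner_sum_right)
  then show "f differentiable (at z)"
    unfolding gderiv_def by (rule differentiableI)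
  show "grad f z = (1 / real n) *\<^sub>R (\<Sum>i=1..n. grad (fi i) z)"
    using * by (rule grad_eqI)
qed

text \<open>The triangle inequality gives the arithmetic mean of the \<open>Li i\<close>, which is
  at most their root mean square. Thus one constant serves both for the smoothness of f and for the
  quantization noise.\<close>

lemma smooth_with_mean:
  fixes f :: "'a::euclidean_space \<Rightarrow> real"
  assumes n: "n \<ge> 1" and f: "\<And>z. f z = (1 / real n) * (\<Sum>i=1..n. fi i z)"
    and fi: "\<And>i. i \<in> {1..n} \<Longrightarrow> smooth_with (Li i) (fi i)"
  shows "smooth_with (sqrt ((1 / real n) * (\<Sum>i=1..n. (Li i)\<^sup>2))) f"
  unfolding smooth_with_def
proof (intro conjI allI)
  fix x y
  have "norm (grad f x - grad f y) = (1 / real n) * norm (\<Sum>i=1..n. grad (fi i) x - grad (fi i) y)"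
    using grad_mean(2)[OF f fi] by (simp add: sum_subtractf flip: scaleR_diff_right)
  also have "\<dots> \<le> (1 / real n) * (\<Sum>i=1..n. Li i * norm (x - y))"
    using fi by (intro mult_left_mono sum_norm_le) (auto simp: smooth_with_def)
  also have "\<dots> = ((\<Sum>i=1..n. Li i) / real n) * norm (x - y)"
    by (simp add: sum_distrib_right)
  also have "\<dots> \<le> sqrt ((1 / real n) * (\<Sum>i=1..n. (Li i)\<^sup>2)) * norm (x - y)"
  proof (intro mult_right_mono real_le_rsqrt)
    have "(\<Sum>i=1..n. Li i)\<^sup>2 \<le> (\<Sum>i=1..n. (Li i)\<^sup>2) * real n"
      using sum_squared_le_sum_of_squares[of Li "{1..n}"] by simp
    then show "((\<Sum>i=1..n. Li i) / real n)\<^sup>2 \<le> (1 / real n) * (\<Sum>i=1..n. (Li i)\<^sup>2)"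
      using n by (simp add: power_divide divide_simps power2_eq_square)
  qed simp
  finally show "norm (grad f x - grad f y) \<le> sqrt ((1 / real n) * (\<Sum>i=1..n. (Li i)\<^sup>2)) * norm (x - y)" .
qed (use grad_mean(1)[OF f fi] in auto)

text \<open>Polarisation turns the cross term of the descent inequality into minus half of
  \<open>G\<close> and \<open>N\<close> plus half the squared error of the direction. The
  Polyak-Lojasiewicz condition consumes \<open>G\<close>, and \<open>N\<close> is expressed by the
  step length so that it can later pay for the growth of the error.\<close>

lemma gradient_step_PL:
  fixes f :: "'a::euclidean_space \<Rightarrow> real"
  assumes "smooth_with L f" and PL: "(norm (grad f x))\<^sup>2 \<ge> 2 * \<mu> * (f x - f xstar)"
    and "\<gamma> > 0" and x': "x' = x - \<gamma> *\<^sub>R g"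
  shows "f x' - f xstar \<le> (1 - \<gamma> * \<mu>) * (f x - f xstar)
    - (1 / (2 * \<gamma>) - L / 2) * (norm (x' - x))\<^sup>2 + \<gamma> / 2 * (norm (g - grad f x))\<^sup>2"
proof -
  define G N P where "G = (norm (grad f x))\<^sup>2" and "N = (norm g)\<^sup>2" and "P = grad f x \<bullet> g"
  have nx: "(norm (x' - x))\<^sup>2 = \<gamma>\<^sup>2 * N"
    by (simp add: x' N_def power_mult_distrib)
  have ng: "(norm (g - grad f x))\<^sup>2 = N - 2 * P + G"
    unfolding N_def P_def G_def power2_norm_eq_inner
    by (simp add: inner_diff_left inner_diff_right inner_commute)
  have "grad f x \<bullet> (x' - x) = - \<gamma> * P"
    by (simp add: x' P_def)
  then have "f x' \<le> f x - \<gamma> * P + L / 2 * (\<gamma>\<^sup>2 * N)"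
    using smooth_with_descent[OF assms(1), of x' x] nx by simp
  moreover have "\<gamma> / 2 * (2 * \<mu> * (f x - f xstar)) \<le> \<gamma> / 2 * G"
    using PL \<open>\<gamma> > 0\<close> unfolding G_def by (intro mult_left_mono) auto
  moreover have "\<gamma> / 2 * (2 * \<mu> * (f x - f xstar)) = \<gamma> * \<mu> * (f x - f xstar)"
      and "\<gamma> / 2 * (N - 2 * P + G) = \<gamma> / 2 * N - \<gamma> * P + \<gamma> / 2 * G"
    by (simp_all add: field_simps)
  ultimately have "f x' - f xstar \<le> (f x - f xstar) - \<gamma> * \<mu> * (f x - f xstar)
      - \<gamma> / 2 * N + L / 2 * (\<gamma>\<^sup>2 * N) + \<gamma> / 2 * (N - 2 * P + G)"
    by linarith
  also have "\<gamma> / 2 * N = 1 / (2 * \<gamma>) * (\<gamma>\<^sup>2 * N)"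
    using \<open>\<gamma> > 0\<close> by (simp add: field_simps power2_eq_square)
  finally show ?thesis
    unfolding nx ng by (simp add: algebra_simps)
qed

text \<open>With \<open>L \<le> 0\<close> the function lies below its tangents, so a long enough
  step along the negative gradient falls below the minimum; \<open>t\<close> makes the tangent drop
  to \<open>f xstar - 1\<close>. Positivity of \<open>L\<close> keeps the denominator in the
  stepsize bound positive.\<close>

lemma PL_smooth_pos:
  fixes f :: "'a::euclidean_space \<Rightarrow> real"
  assumes "smooth_with L f" and PL: "\<And>z. (norm (grad f z))\<^sup>2 \<ge> 2 * \<mu> * (f z - f xstar)"
    and "\<mu> > 0" and min: "\<And>z. f xstar \<le> f z" and "f xstar < f x0"
  shows "L > 0"
proof (rule ccontr)
  assume "\<not> L > 0"
  then have L: "L \<le> 0" by simp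
  define G where "G = (norm (grad f x0))\<^sup>2"
  define t where "t = (f x0 - f xstar + 1) / G"
  have "0 < 2 * \<mu> * (f x0 - f xstar)"
    using assms by simp
  then have "G > 0"
    using PL[of x0] unfolding G_def by linarith
  have "L / 2 * (norm (t *\<^sub>R grad f x0))\<^sup>2 \<le> 0"
    using L by (simp add: mult_nonpos_nonneg)
  then have "f (x0 - t *\<^sub>R grad f x0) \<le> f x0 - t * G"
    using smooth_with_descent[OF assms(1), of "x0 - t *\<^sub>R grad f x0" x0]
    by (simp add: G_def power2_norm_eq_inner)
  also have "t * G = f x0 - f xstar + 1"
    using \<open>G > 0\<close> by (simp add: t_def)
  finally show False
    using min[of "x0 - t *\<^sub>R grad f x0"] by simp
qed

text \<open>The Lyapunov function is \<open>\<delta> k + \<gamma> / p * e k\<close>: the stepsize restriction makes the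
  coefficient of the squared step length \<open>r k\<close> nonpositive.\<close>

lemma lyapunov_rate:
  fixes \<delta> e r :: "nat \<Rightarrow> real"
  assumes \<delta>: "\<And>k. \<delta> (Suc k) \<le> (1 - \<gamma> * \<mu>) * \<delta> k - (1 / (2 * \<gamma>) - L / 2) * r k + \<gamma> / 2 * e k"
    and e: "\<And>k. e (Suc k) \<le> (1 - p) * (e k + B * r k) + p * s"
    and nonneg: "\<And>k. 0 \<le> r k" "\<And>k. 0 \<le> e k"
    and pos: "0 < p" "0 < \<mu>" "0 < \<gamma>" "0 \<le> s" and \<gamma>p: "\<gamma> \<le> p / (2 * \<mu>)" and "p \<le> 1"
    and step: "2 * (1 - p) / p * B * \<gamma>\<^sup>2 + L * \<gamma> \<le> 1"
  shows "\<delta> k + \<gamma> / p * e k \<le> (1 - \<gamma> * \<mu>) ^ k * (\<delta> 0 + \<gamma> / p * e 0) + s / \<mu>"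
proof (induction k)
  case 0
  then show ?case using pos by simp
next
  case (Suc k)
  define q where "q = 1 - \<gamma> * \<mu>"
  have \<gamma>\<mu>: "\<gamma> * \<mu> \<le> p / 2"
    using \<gamma>p pos by (simp add: field_simps)
  then have "0 \<le> q"
    using \<open>p \<le> 1\<close> by (simp add: q_def)
  have "\<delta> (Suc k) + \<gamma> / p * e (Suc k)
      \<le> (q * \<delta> k - (1 / (2 * \<gamma>) - L / 2) * r k + \<gamma> / 2 * e k)
        + \<gamma> / p * ((1 - p) * (e k + B * r k) + p * s)"
    using pos unfolding q_def by (intro add_mono mult_left_mono \<delta> e) auto
  \<comment> \<open>The weight \<open>\<gamma> / p\<close> is chosen for this: the term
    \<open>\<gamma> / 2 * e k\<close> of the descent equals \<open>\<gamma> / p\<close> times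
    \<open>p / 2 * e k\<close>, so half of the contraction 1 - p is kept, and
    \<open>\<gamma> * \<mu> \<le> p / 2\<close> makes the remaining factor at most
    \<open>q\<close>.\<close>
  also have "\<dots> = q * \<delta> k + \<gamma> / p * ((1 - p / 2) * e k)
      - (1 - (2 * (1 - p) / p * B * \<gamma>\<^sup>2 + L * \<gamma>)) / (2 * \<gamma>) * r k + \<gamma> * s"
    using pos by (simp add: field_simps power2_eq_square)
  also have "\<dots> \<le> q * \<delta> k + \<gamma> / p * (q * e k) - 0 + \<gamma> * s"
    using step pos nonneg \<gamma>\<mu> \<open>p \<le> 1\<close> unfolding q_def
    by (intro add_mono diff_mono mult_left_mono mult_right_mono mult_nonneg_nonneg
        divide_nonneg_pos) auto
  also have "\<dots> = q * (\<delta> k + \<gamma> / p * e k) + \<gamma> * s"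
    by (simp add: algebra_simps)
  also have "\<dots> \<le> q * (q ^ k * (\<delta> 0 + \<gamma> / p * e 0) + s / \<mu>) + \<gamma> * s"
    using mult_left_mono[OF Suc \<open>0 \<le> q\<close>] by (simp add: q_def)
  \<comment> \<open>\<open>s / \<mu>\<close> is the fixed point of the map sending t to
    \<open>q * t + \<gamma> * s\<close>, because 1 - q = \<open>\<gamma> * \<mu>\<close>.\<close>
  also have "\<dots> = q ^ Suc k * (\<delta> 0 + \<gamma> / p * e 0) + s / \<mu>"
    using pos by (simp add: q_def field_simps)
  finally show ?case
    by (simp add: q_def)
qed

section \<open>One run of the method\<close>

text \<open>Collects what concerns a single run. The stepsize bound, the target accuracy, the size
  of b and the Polyak-Lojasiewicz condition stay outside, so the error recursion and the cost
  formulas hold for any real \<open>\<gamma>\<close> and any p in the unit interval.\<close>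

locale vr_marina =
  fixes M :: "'w measure" and D :: "nat \<Rightarrow> 's measure" and R :: "'r measure"
    and F :: "'s \<Rightarrow> real ^ 'd::finite \<Rightarrow> real"
    and fi :: "nat \<Rightarrow> real ^ 'd \<Rightarrow> real" and f :: "real ^ 'd \<Rightarrow> real"
    and Q :: "'r \<Rightarrow> real ^ 'd \<Rightarrow> real ^ 'd"
    and I I' :: "nat \<Rightarrow> nat \<Rightarrow> nat set"
    and c :: "nat \<Rightarrow> 'w \<Rightarrow> bool" and \<xi> :: "nat \<Rightarrow> nat \<Rightarrow> nat \<Rightarrow> 'w \<Rightarrow> 's"
    and r :: "nat \<Rightarrow> nat \<Rightarrow> 'w \<Rightarrow> 'r"
    and x g :: "nat \<Rightarrow> 'w \<Rightarrow> real ^ 'd" and gl dt m :: "nat \<Rightarrow> nat \<Rightarrow> 'w \<Rightarrow> real ^ 'd"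
    and x0 :: "real ^ 'd" and n b b' :: nat and \<gamma> p \<omega> :: real and Li \<L>i \<sigma>i :: "nat \<Rightarrow> real"
  assumes n: "n \<ge> 1" and p01: "0 \<le> p" "p \<le> 1"
    and D: "\<And>i. i \<in> {1..n} \<Longrightarrow> prob_space (D i)"
    and F_grad_meas:
      "\<And>i. i \<in> {1..n} \<Longrightarrow> (\<lambda>(s, z). grad (F s) z) \<in> borel_measurable (D i \<Otimes>\<^sub>M borel)"
    and f: "\<And>z. f z = (1 / real n) * (\<Sum>i=1..n. fi i z)"
    and smooth: "\<And>i. i \<in> {1..n} \<Longrightarrow> smooth_with (Li i) (fi i)"
    and unbiased: "\<And>i z. i \<in> {1..n} \<Longrightarrow>
        integrable (D i) (\<lambda>s. grad (F s) z) \<and> (LINT s|D i. grad (F s) z) = grad (fi i) z"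
    and variance: "\<And>i z. i \<in> {1..n} \<Longrightarrow>
        integrable (D i) (\<lambda>s. (norm (grad (F s) z - grad (fi i) z))\<^sup>2) \<and>
        (LINT s|D i. (norm (grad (F s) z - grad (fi i) z))\<^sup>2) \<le> (\<sigma>i i)\<^sup>2"
    and Q: "quantization R Q \<omega>"
    and batches: "b' \<ge> 1" "b' \<le> b"
        "\<And>i k. i \<in> {1..n} \<Longrightarrow> card (I i k) = b" "\<And>i k. i \<in> {1..n} \<Longrightarrow> card (I' i k) = b'"
    and sampling: "vr_marina_sampling M D R n p I I' c \<xi> r"
    and run: "vr_marina_run (space M) F Q n \<gamma> I I' x0 c \<xi> r x g gl dt m"
    and avg_smooth: "\<And>i. i \<in> {1..n} \<Longrightarrow> average_smooth M x (fi i) (dt i) b' (\<L>i i)"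
begin

definition source_sets :: "source \<Rightarrow> 'w set set" where
  "source_sets s = (case s of
      Coin k \<Rightarrow> sets (vimage_algebra (space M) (c k) (count_space UNIV))
    | Sample i j k \<Rightarrow> sets (vimage_algebra (space M) (\<xi> i j k) (D i))
    | Seed i k \<Rightarrow> sets (vimage_algebra (space M) (r i k) R))"

definition sources :: "source set" where
  "sources = range Coin \<union> {Sample i j k |i j k. i \<in> {1..n} \<and> j \<in> I i k \<union> I' i k} \<union>
     {Seed i k |i k. i \<in> {1..n}}"

sublocale independent_sources M source_sets sources
proof -
  interpret prob_space M
    using sampling by (simp add: vr_marina_sampling_def)
  show "independent_sources M source_sets sources"
  proof
    show "indep_sets source_sets sources"
      using sampling unfolding vr_marina_sampling_def source_sets_def[abs_def] sources_def by simp
    show "Int_stable (source_sets s)" for s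
      by (cases s) (simp_all add: source_sets_def sets.Int_stable)
  qed
qed

sublocale R: prob_space R
  using Q by (simp add: quantization_def)

lemma b_pos: "b \<ge> 1"
  using batches by simp

text \<open>An infinite set has \<open>card\<close> 0, whereas both batch sizes are
  positive.\<close>

lemma finite_batches:
  assumes "i \<in> {1..n}"
  shows "finite (I i k)" "finite (I' i k)"
  using batches assms b_pos by (metis card.infinite not_one_le_zero)+

lemma coin:
  shows "Coin k \<in> S \<Longrightarrow> c k \<in> measurable (info S) (count_space UNIV)"
    and "distr M (count_space UNIV) (c k) = measure_pmf (bernoulli_pmf p)"
proof -
  show "distr M (count_space UNIV) (c k) = measure_pmf (bernoulli_pmf p)"
    using sampling by (simp add: vr_marina_sampling_def)
  show "Coin k \<in> S \<Longrightarrow> c k \<in> measurable (info S) (count_space UNIV)"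
    by (rule source_measurable_info[of "Coin k"]) (auto simp: sources_def source_sets_def)
qed

lemma sample:
  assumes "i \<in> {1..n}" "j \<in> I i k \<union> I' i k"
  shows "Sample i j k \<in> S \<Longrightarrow> \<xi> i j k \<in> measurable (info S) (D i)"
    and "distr M (D i) (\<xi> i j k) = D i"
proof -
  have *: "\<xi> i j k \<in> measurable M (D i)" "distr M (D i) (\<xi> i j k) = D i"
    using sampling assms unfolding vr_marina_sampling_def by blast+
  then show "distr M (D i) (\<xi> i j k) = D i"
    by simp
  show "Sample i j k \<in> S \<Longrightarrow> \<xi> i j k \<in> measurable (info S) (D i)"
    by (rule source_measurable_info[of "Sample i j k"])
       (use assms measurable_space[OF *(1)] in \<open>auto simp: sources_def source_sets_def\<close>)
qed

lemma seed:
  assumes "i \<in> {1..n}"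
  shows "Seed i k \<in> S \<Longrightarrow> r i k \<in> measurable (info S) R"
    and "distr M R (r i k) = R"
proof -
  have *: "r i k \<in> measurable M R" "distr M R (r i k) = R"
    using sampling assms unfolding vr_marina_sampling_def by blast+
  then show "distr M R (r i k) = R"
    by simp
  show "Seed i k \<in> S \<Longrightarrow> r i k \<in> measurable (info S) R"
    by (rule source_measurable_info[of "Seed i k"])
       (use assms measurable_space[OF *(1)] in \<open>auto simp: sources_def source_sets_def\<close>)
qed

lemma grad_fi_measurable [measurable]: "i \<in> {1..n} \<Longrightarrow> grad (fi i) \<in> borel_measurable borel"
  using smooth by (rule borel_measurable_grad)

lemma grad_f: "grad f z = (1 / real n) *\<^sub>R (\<Sum>i=1..n. grad (fi i) z)"
  by (rule grad_mean(2)[OF f smooth])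

subsection \<open>Gradient noise\<close>

definition noise :: "nat \<Rightarrow> real ^ 'd \<Rightarrow> 's \<Rightarrow> real ^ 'd" where
  "noise i z s = grad (F s) z - grad (fi i) z"

lemma noise_measurable:
  assumes i: "i \<in> {1..n}"
  shows "(\<lambda>(z, s). noise i z s) \<in> borel_measurable (borel \<Otimes>\<^sub>M D i)"
proof -
  note [measurable] = F_grad_meas[OF i] grad_fi_measurable[OF i]
  have "(\<lambda>(z, s). (case (s, z) of (s, z) \<Rightarrow> grad (F s) z) - grad (fi i) z) \<in> borel_measurable (borel \<Otimes>\<^sub>M D i)"
    by measurable
  then show ?thesis
    by (simp add: noise_def)
qed

lemma noise_info:
  assumes "i \<in> {1..n}" "j \<in> I i k \<union> I' i k" "Sample i j k \<in> S" "X \<in> borel_measurable (info S)"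
  shows "(\<lambda>w. noise i (X w) (\<xi> i j k w)) \<in> borel_measurable (info S)"
proof -
  have "(\<lambda>w. (X w, \<xi> i j k w)) \<in> measurable (info S) (borel \<Otimes>\<^sub>M D i)"
    using assms(4) sample(1)[OF assms(1-3)] by measurable
  from measurable_compose[OF this noise_measurable[OF assms(1)]] show ?thesis
    by simp
qed

text \<open>The evaluation point may be random as long as it does not depend on this sample:
  freezing it reduces the claim to the variance hypothesis at a fixed point.\<close>

lemma noise_bound:
  assumes i: "i \<in> {1..n}" and j: "j \<in> I i k \<union> I' i k" and X: "X \<in> borel_measurable (info S)"
    and S: "Sample i j k \<notin> S"
  shows "square_integrable M (\<lambda>w. noise i (X w) (\<xi> i j k w))" (is ?sq)
    and "mean_sq M (\<lambda>w. noise i (X w) (\<xi> i j k w)) \<le> (\<sigma>i i)\<^sup>2"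
proof -
  define T where "T = {Sample i j k}"
  have \<xi>: "\<xi> i j k \<in> measurable (info T) (D i)"
    using sample(1)[OF i j] by (simp add: T_def)
  have h: "(\<lambda>(z, s). ennreal ((norm (noise i z s))\<^sup>2)) \<in> borel_measurable (borel \<Otimes>\<^sub>M D i)"
    using noise_measurable[OF i] by measurable
  have "(\<integral>\<^sup>+w. ennreal ((norm (noise i (X w) (\<xi> i j k w)))\<^sup>2) \<partial>M)
      = (\<integral>\<^sup>+w. (\<integral>\<^sup>+s. ennreal ((norm (noise i (X w) s))\<^sup>2) \<partial>D i) \<partial>M)"
    using nn_integral_fresh[OF X \<xi> _ sample(2)[OF i j] h] S by (simp add: T_def)
  also have "\<dots> \<le> (\<integral>\<^sup>+w. ennreal ((\<sigma>i i)\<^sup>2) \<partial>M)"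
  proof (rule nn_integral_mono)
    fix w
    have "(\<integral>\<^sup>+s. ennreal ((norm (noise i (X w) s))\<^sup>2) \<partial>D i)
        = ennreal (LINT s|D i. (norm (noise i (X w) s))\<^sup>2)"
      using variance[OF i, of "X w"] unfolding noise_def by (intro nn_integral_eq_integral) auto
    then show "(\<integral>\<^sup>+s. ennreal ((norm (noise i (X w) s))\<^sup>2) \<partial>D i) \<le> ennreal ((\<sigma>i i)\<^sup>2)"
      using variance[OF i, of "X w"] unfolding noise_def by (simp add: ennreal_leI)
  qed
  also have "\<dots> = ennreal ((\<sigma>i i)\<^sup>2)"
    by (simp add: emeasure_space_1)
  finally have le: "(\<integral>\<^sup>+w. ennreal ((norm (noise i (X w) (\<xi> i j k w)))\<^sup>2) \<partial>M) \<le> ennreal ((\<sigma>i i)\<^sup>2)" .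
  have meas: "(\<lambda>w. noise i (X w) (\<xi> i j k w)) \<in> borel_measurable M"
    by (rule measurable_info[OF noise_info[OF i j, of UNIV]])
       (auto intro: measurable_info_mono[OF X])
  show ?sq "mean_sq M (\<lambda>w. noise i (X w) (\<xi> i j k w)) \<le> (\<sigma>i i)\<^sup>2"
    using square_integrableI_nn[OF meas le] by simp_all
qed

text \<open>S may contain the other samples of the same batch; this is how pairwise orthogonality
  inside a batch is obtained.\<close>

lemma noise_orth:
  assumes i: "i \<in> {1..n}" and j: "j \<in> I i k \<union> I' i k" and X: "X \<in> borel_measurable (info S)"
    and S: "Sample i j k \<notin> S" and U: "U \<in> borel_measurable (info S)" "square_integrable M U"
  shows "orth M U (\<lambda>w. noise i (X w) (\<xi> i j k w))"
proof -
  define T where "T = {Sample i j k}"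
  have \<xi>: "\<xi> i j k \<in> measurable (info T) (D i)"
    using sample(1)[OF i j] by (simp add: T_def)
  interpret Di: prob_space "D i"
    using D[OF i] .
  have "orth M U (\<lambda>w. (case (X w, \<xi> i j k w) of (z, s) \<Rightarrow> noise i z s))"
  proof (rule orth_fresh[OF U X \<xi> _ sample(2)[OF i j] noise_measurable[OF i]])
    show "S \<inter> T = {}"
      using S by (simp add: T_def)
    show "square_integrable M (\<lambda>w. (case (X w, \<xi> i j k w) of (z, s) \<Rightarrow> noise i z s))"
      using noise_bound(1)[OF i j X S] by simp
    fix z
    show "integrable (D i) (\<lambda>s. case (z, s) of (z, s) \<Rightarrow> noise i z s) \<and>
        (LINT s|D i. (case (z, s) of (z, s) \<Rightarrow> noise i z s)) = 0"
      using unbiased[OF i, of z] by (simp add: noise_def Di.prob_space)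
  qed
  then show ?thesis
    by simp
qed

text \<open>The error is an average of n * b noise terms. For two of them, the first is determined
  by S and its own sample, while the sample of the second is still fresh; hence they are orthogonal
  and the second moments add up. A random point is allowed so that both the initial batch and the
  later full rounds are covered.\<close>

lemma minibatch_error:
  fixes k S
  defines "T \<equiv> {Sample i j k |i j. True}"
  assumes X: "X \<in> borel_measurable (info S)" and ST: "S \<inter> T = {}"
  defines "A \<equiv> \<lambda>w. (1 / real n) *\<^sub>R (\<Sum>i=1..n. minibatch_grad F (I i k) (\<lambda>j. \<xi> i j k w) (X w)) - grad f (X w)"
  shows "A \<in> borel_measurable (info (S \<union> T))" and "square_integrable M A"
    and "mean_sq M A \<le> (1 / real n) * (\<Sum>i=1..n. (\<sigma>i i)\<^sup>2) / (real n * real b)"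
proof -
  define P where "P = (SIGMA i:{1..n}. I i k)"
  define N where "N t w = noise (fst t) (X w) (\<xi> (fst t) (snd t) k w)" for t w
  define a where "a = 1 / (real n * real b)"
  have [simp]: "finite P"
    using finite_batches by (auto simp: P_def)
  have X': "X \<in> borel_measurable (info (S \<union> V))" for V
    by (rule measurable_info_mono[OF X]) auto
  have P: "fst t \<in> {1..n}" "snd t \<in> I (fst t) k \<union> I' (fst t) k" if "t \<in> P" for t
    using that by (auto simp: P_def)
  have N_info: "N t \<in> borel_measurable (info (S \<union> {Sample (fst t) (snd t) k}))" if "t \<in> P" for t
    unfolding N_def by (rule noise_info[OF P[OF that] _ X']) simp
  have notin: "Sample i j k \<notin> S" for i j
    using ST by (auto simp: T_def)
  have N_sq: "square_integrable M (N t)" and N_le: "mean_sq M (N t) \<le> (\<sigma>i (fst t))\<^sup>2" if "t \<in> P" for t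
    using noise_bound[OF P[OF that] X notin] by (simp_all add: N_def[abs_def])
  have N_orth: "orth M (N s) (N t)" if "s \<in> P" "t \<in> P" "s \<noteq> t" for s t
    unfolding N_def[of t, abs_def]
    by (rule noise_orth[OF P[OF that(2)] X' _ N_info[OF that(1)] N_sq[OF that(1)]])
       (use that(3) notin in \<open>auto simp: prod_eq_iff\<close>)
  have A_eq: "A w = a *\<^sub>R (\<Sum>t\<in>P. N t w)" for w
  proof -
    have "(1 / real b) *\<^sub>R (\<Sum>j\<in>I i k. noise i (X w) (\<xi> i j k w))
        = minibatch_grad F (I i k) (\<lambda>j. \<xi> i j k w) (X w) - grad (fi i) (X w)" if "i \<in> {1..n}" for i
      using batches(3)[OF that, of k] b_pos
      by (simp add: noise_def sum_subtractf minibatch_grad_def scaleR_diff_right sum_constant_scaleR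
          del: sum_constant)
    then have "A w = (1 / real n) *\<^sub>R (\<Sum>i=1..n. (1 / real b) *\<^sub>R (\<Sum>j\<in>I i k. noise i (X w) (\<xi> i j k w)))"
      by (simp add: A_def grad_f sum_subtractf scaleR_diff_right)
    also have "\<dots> = a *\<^sub>R (\<Sum>i=1..n. \<Sum>j\<in>I i k. N (i, j) w)"
      by (simp add: a_def N_def scaleR_sum_right)
    also have "(\<Sum>i=1..n. \<Sum>j\<in>I i k. N (i, j) w) = (\<Sum>t\<in>P. N t w)"
      using finite_batches by (simp add: P_def sum.Sigma)
    finally show ?thesis .
  qed
  then have A: "A = (\<lambda>w. a *\<^sub>R (\<Sum>t\<in>P. N t w))"
    by auto
  have [measurable]: "N t \<in> borel_measurable (info (S \<union> T))" if "t \<in> P" for t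
    by (rule measurable_info_mono[OF N_info[OF that]]) (auto simp: T_def)
  show "A \<in> borel_measurable (info (S \<union> T))"
    unfolding A by measurable
  show "square_integrable M A"
    unfolding A using N_sq by (intro square_integrable_scaleR square_integrable_sum)
  have "mean_sq M A = a\<^sup>2 * (\<Sum>t\<in>P. mean_sq M (N t))"
    unfolding A mean_sq_scaleR using N_sq N_orth by (subst mean_sq_sum_orth) auto
  also have "\<dots> \<le> a\<^sup>2 * (\<Sum>t\<in>P. (\<sigma>i (fst t))\<^sup>2)"
    by (intro mult_left_mono sum_mono N_le) auto
  also have "(\<Sum>t\<in>P. (\<sigma>i (fst t))\<^sup>2) = (\<Sum>i=1..n. \<Sum>j\<in>I i k. (\<sigma>i i)\<^sup>2)"
    unfolding P_def using finite_batches by (subst sum.Sigma) (auto simp: case_prod_beta)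
  also have "\<dots> = real b * (\<Sum>i=1..n. (\<sigma>i i)\<^sup>2)"
    using batches(3) by (simp add: sum_distrib_left)
  also have "a\<^sup>2 * (real b * (\<Sum>i=1..n. (\<sigma>i i)\<^sup>2)) = (1 / real n) * (\<Sum>i=1..n. (\<sigma>i i)\<^sup>2) / (real n * real b)"
    using b_pos n by (simp add: a_def power2_eq_square)
  finally show "mean_sq M A \<le> (1 / real n) * (\<Sum>i=1..n. (\<sigma>i i)\<^sup>2) / (real n * real b)" .
qed

subsection \<open>Quantization noise\<close>

lemma Q_measurable: "(\<lambda>(z, s). Q s z) \<in> borel_measurable (borel \<Otimes>\<^sub>M R)"
proof -
  have [measurable]: "(\<lambda>(s, z). Q s z) \<in> borel_measurable (R \<Otimes>\<^sub>M borel)"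
    using Q by (simp add: quantization_def)
  have "(\<lambda>(z, s). case (s, z) of (s, z) \<Rightarrow> Q s z) \<in> borel_measurable (borel \<Otimes>\<^sub>M R)"
    by measurable
  then show ?thesis
    by simp
qed

lemma Q_info:
  assumes "i \<in> {1..n}" "Seed i k \<in> S" "X \<in> borel_measurable (info S)"
  shows "(\<lambda>w. Q (r i k w) (X w)) \<in> borel_measurable (info S)"
proof -
  have "(\<lambda>w. (X w, r i k w)) \<in> measurable (info S) (borel \<Otimes>\<^sub>M R)"
    using assms(3) seed(1)[OF assms(1,2)] by measurable
  from measurable_compose[OF this Q_measurable] show ?thesis
    by simp
qed

text \<open>The quantization error is controlled relative to the vector, not uniformly, so it has a
  finite second moment only once the vector has one.\<close>

lemma Q_bound:
  assumes i: "i \<in> {1..n}" and X: "X \<in> borel_measurable (info S)" "square_integrable M X"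
    and S: "Seed i k \<notin> S"
  shows "square_integrable M (\<lambda>w. Q (r i k w) (X w) - X w)" (is ?sq)
    and "mean_sq M (\<lambda>w. Q (r i k w) (X w) - X w) \<le> \<omega> * mean_sq M X"
proof -
  define T where "T = {Seed i k}"
  have r: "r i k \<in> measurable (info T) R"
    using seed(1)[OF i] by (simp add: T_def)
  have \<omega>: "0 < \<omega>"
    using Q by (simp add: quantization_def)
  have h: "(\<lambda>(z, s). ennreal ((norm (Q s z - z))\<^sup>2)) \<in> borel_measurable (borel \<Otimes>\<^sub>M R)"
    using Q_measurable by measurable
  have "(\<integral>\<^sup>+w. ennreal ((norm (Q (r i k w) (X w) - X w))\<^sup>2) \<partial>M)
      = (\<integral>\<^sup>+w. (\<integral>\<^sup>+s. ennreal ((norm (Q s (X w) - X w))\<^sup>2) \<partial>R) \<partial>M)"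
    using nn_integral_fresh[OF X(1) r _ seed(2)[OF i] h] S by (simp add: T_def)
  also have "\<dots> \<le> (\<integral>\<^sup>+w. ennreal \<omega> * ennreal ((norm (X w))\<^sup>2) \<partial>M)"
  proof (rule nn_integral_mono)
    fix w
    have *: "integrable R (\<lambda>s. (norm (Q s (X w) - X w))\<^sup>2)"
        "(LINT s|R. (norm (Q s (X w) - X w))\<^sup>2) \<le> \<omega> * (norm (X w))\<^sup>2"
      using Q by (auto simp: quantization_def)
    have "(\<integral>\<^sup>+s. ennreal ((norm (Q s (X w) - X w))\<^sup>2) \<partial>R)
        = ennreal (LINT s|R. (norm (Q s (X w) - X w))\<^sup>2)"
      using * by (intro nn_integral_eq_integral) auto
    then show "(\<integral>\<^sup>+s. ennreal ((norm (Q s (X w) - X w))\<^sup>2) \<partial>R) \<le> ennreal \<omega> * ennreal ((norm (X w))\<^sup>2)"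
      using * \<omega> by (simp add: ennreal_leI flip: ennreal_mult)
  qed
  also have "\<dots> = ennreal (\<omega> * mean_sq M X)"
    using X(2) measurable_info[OF X(1)] \<omega>
    by (subst nn_integral_cmult) (simp_all add: integral_ennreal_mean_sq mean_sq_nonneg ennreal_mult)
  finally have le: "(\<integral>\<^sup>+w. ennreal ((norm (Q (r i k w) (X w) - X w))\<^sup>2) \<partial>M) \<le> ennreal (\<omega> * mean_sq M X)" .
  have "(\<lambda>w. Q (r i k w) (X w)) \<in> borel_measurable M"
    by (rule measurable_info[OF Q_info[OF i, of _ UNIV]])
       (auto intro: measurable_info_mono[OF X(1)])
  then have meas: "(\<lambda>w. Q (r i k w) (X w) - X w) \<in> borel_measurable M"
    using measurable_info[OF X(1)] by measurable
  show ?sq "mean_sq M (\<lambda>w. Q (r i k w) (X w) - X w) \<le> \<omega> * mean_sq M X"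
    using square_integrableI_nn[OF meas le] \<omega> by (simp_all add: mean_sq_nonneg)
qed

lemma Q_orth:
  assumes i: "i \<in> {1..n}" and X: "X \<in> borel_measurable (info S)" "square_integrable M X"
    and S: "Seed i k \<notin> S" and U: "U \<in> borel_measurable (info S)" "square_integrable M U"
  shows "orth M U (\<lambda>w. Q (r i k w) (X w) - X w)"
proof -
  define T where "T = {Seed i k}"
  have r: "r i k \<in> measurable (info T) R"
    using seed(1)[OF i] by (simp add: T_def)
  have h: "(\<lambda>(z, s). Q s z - z) \<in> borel_measurable (borel \<Otimes>\<^sub>M R)"
    using Q_measurable by measurable
  have "orth M U (\<lambda>w. (case (X w, r i k w) of (z, s) \<Rightarrow> Q s z - z))"
  proof (rule orth_fresh[OF U X(1) r _ seed(2)[OF i] h])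
    show "S \<inter> T = {}"
      using S by (simp add: T_def)
    show "square_integrable M (\<lambda>w. (case (X w, r i k w) of (z, s) \<Rightarrow> Q s z - z))"
      using Q_bound(1)[OF i X S] by simp
    fix z
    show "integrable R (\<lambda>s. case (z, s) of (z, s) \<Rightarrow> Q s z - z) \<and>
        (LINT s|R. (case (z, s) of (z, s) \<Rightarrow> Q s z - z)) = 0"
      using Q by (auto simp: quantization_def R.prob_space)
  qed
  then show ?thesis
    by simp
qed

subsection \<open>The iterates\<close>

text \<open>Batch k is drawn while \<open>g k\<close> is formed, whereas coin and seeds number k
  first act on \<open>g (Suc k)\<close>; hence \<le> for samples and < for the others. These sources
  determine \<open>x k\<close> and \<open>g k\<close>, and therefore also
  \<open>x (Suc k)\<close>.\<close>

definition past :: "nat \<Rightarrow> source set" where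
  "past k = {s. case s of Coin l \<Rightarrow> l < k | Sample i j l \<Rightarrow> l \<le> k | Seed i l \<Rightarrow> l < k}"

text \<open>The moment in iteration k at which every \<open>dt i k\<close> is known, but the seeds
  and the coin of that iteration are not.\<close>

definition drawn :: "nat \<Rightarrow> source set" where
  "drawn k = past k \<union> {Sample i j (Suc k) |i j. True}"

definition err :: "nat \<Rightarrow> 'w \<Rightarrow> real ^ 'd" where
  "err k w = g k w - grad f (x k w)"

definition dx :: "nat \<Rightarrow> 'w \<Rightarrow> real ^ 'd" where
  "dx k w = x (Suc k) w - x k w"

definition dgrad :: "nat \<Rightarrow> nat \<Rightarrow> 'w \<Rightarrow> real ^ 'd" where
  "dgrad i k w = grad (fi i) (x (Suc k) w) - grad (fi i) (x k w)"

definition dt_noise :: "nat \<Rightarrow> nat \<Rightarrow> 'w \<Rightarrow> real ^ 'd" where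
  "dt_noise i k w = dt i k w - dgrad i k w"

definition Q_noise :: "nat \<Rightarrow> nat \<Rightarrow> 'w \<Rightarrow> real ^ 'd" where
  "Q_noise i k w = Q (r i k w) (dt i k w) - dt i k w"

definition batch_mean :: "nat \<Rightarrow> (real ^ 'd) \<Rightarrow> 'w \<Rightarrow> real ^ 'd" where
  "batch_mean k z w = (1 / real n) *\<^sub>R (\<Sum>i=1..n. minibatch_grad F (I i k) (\<lambda>j. \<xi> i j k w) z)"

lemma run_eqs:
  assumes "w \<in> space M"
  shows x_0: "x 0 w = x0"
    and x_Suc: "x (Suc k) w = x k w - \<gamma> *\<^sub>R g k w"
    and g_eq: "g k w = (1 / real n) *\<^sub>R (\<Sum>i=1..n. gl i k w)"
    and m_0: "i \<in> {1..n} \<Longrightarrow> m i 0 w = minibatch_grad F (I i 0) (\<lambda>j. \<xi> i j 0 w) x0"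
    and gl_0: "i \<in> {1..n} \<Longrightarrow> gl i 0 w = m i 0 w"
    and dt_eq: "i \<in> {1..n} \<Longrightarrow> dt i k w = (1 / real (card (I' i (Suc k)))) *\<^sub>R
                (\<Sum>j\<in>I' i (Suc k). grad (F (\<xi> i j (Suc k) w)) (x (Suc k) w)
                                - grad (F (\<xi> i j (Suc k) w)) (x k w))"
    and m_Suc: "i \<in> {1..n} \<Longrightarrow> m i (Suc k) w =
                (if c k w then minibatch_grad F (I i (Suc k)) (\<lambda>j. \<xi> i j (Suc k) w) (x (Suc k) w)
                 else Q (r i k w) (dt i k w))"
    and gl_Suc: "i \<in> {1..n} \<Longrightarrow> gl i (Suc k) w = (if c k w then m i (Suc k) w else g k w + m i (Suc k) w)"
  using run assms unfolding vr_marina_run_def by blast+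

lemma g_0: "w \<in> space M \<Longrightarrow> g 0 w = batch_mean 0 x0 w"
  using g_eq[of w 0] gl_0[of w] m_0[of w] by (simp add: batch_mean_def)

lemma g_Suc:
  assumes "w \<in> space M"
  shows "g (Suc k) w = (if c k w then batch_mean (Suc k) (x (Suc k) w) w
     else g k w + (1 / real n) *\<^sub>R (\<Sum>i=1..n. Q (r i k w) (dt i k w)))"
proof -
  have "(1 / real n) *\<^sub>R (\<Sum>i=1..n. g k w + v i) = g k w + (1 / real n) *\<^sub>R (\<Sum>i=1..n. v i)" for v
    using n by (simp add: sum.distrib scaleR_add_right sum_constant_scaleR del: sum_constant)
  then show ?thesis
    using g_eq[OF assms, of "Suc k"] gl_Suc[OF assms] m_Suc[OF assms] by (simp add: batch_mean_def)
qed

text \<open>One sample is evaluated at both points, so every summand is a difference of two noise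
  terms with a single source. In this form the freshness of the samples can be applied.\<close>

lemma dt_noise_eq:
  assumes "w \<in> space M" and i: "i \<in> {1..n}"
  shows "dt_noise i k w = (1 / real b') *\<^sub>R
    (\<Sum>j\<in>I' i (Suc k). noise i (x (Suc k) w) (\<xi> i j (Suc k) w) - noise i (x k w) (\<xi> i j (Suc k) w))"
proof -
  have "(\<Sum>j\<in>I' i (Suc k). dgrad i k w) = real b' *\<^sub>R dgrad i k w"
    using batches(4)[OF i] by (simp add: sum_constant_scaleR del: sum_constant)
  then have "dgrad i k w = (1 / real b') *\<^sub>R (\<Sum>j\<in>I' i (Suc k). dgrad i k w)"
    using batches(1) by simp
  then have "dt_noise i k w = (1 / real b') *\<^sub>R (\<Sum>j\<in>I' i (Suc k).
      (grad (F (\<xi> i j (Suc k) w)) (x (Suc k) w) - grad (F (\<xi> i j (Suc k) w)) (x k w)) - dgrad i k w)"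
    unfolding dt_noise_def dt_eq[OF assms] batches(4)[OF i]
    by (simp only: sum_subtractf scaleR_diff_right)
  then show ?thesis
    by (simp add: noise_def dgrad_def algebra_simps)
qed

text \<open>In a quantized round the mean of the true differences \<open>dgrad\<close> equals the
  change of \<open>grad f\<close> between the iterates and cancels; only the old error and the two
  kinds of noise survive.\<close>

lemma err_Suc:
  assumes "w \<in> space M"
  shows "err (Suc k) w = (if c k w then batch_mean (Suc k) (x (Suc k) w) w - grad f (x (Suc k) w)
     else err k w + ((1 / real n) *\<^sub>R (\<Sum>i=1..n. dt_noise i k w) + (1 / real n) *\<^sub>R (\<Sum>i=1..n. Q_noise i k w)))"
proof -
  have "grad f (x (Suc k) w) - grad f (x k w) = (1 / real n) *\<^sub>R (\<Sum>i=1..n. dgrad i k w)"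
    by (simp add: grad_f dgrad_def sum_subtractf scaleR_diff_right)
  moreover have "(\<Sum>i=1..n. Q (r i k w) (dt i k w))
      = (\<Sum>i=1..n. dgrad i k w) + ((\<Sum>i=1..n. dt_noise i k w) + (\<Sum>i=1..n. Q_noise i k w))"
    by (simp add: dt_noise_def Q_noise_def sum_subtractf)
  ultimately show ?thesis
    unfolding err_def g_Suc[OF assms] by (simp add: scaleR_add_right algebra_simps)
qed

subsection \<open>Measurability\<close>

lemma grad_f_measurable [measurable]: "grad f \<in> borel_measurable borel"
proof -
  have "grad f = (\<lambda>z. (1 / real n) *\<^sub>R (\<Sum>i=1..n. grad (fi i) z))"
    by (rule ext) (rule grad_f)
  then show ?thesis
    by simp
qed

lemma past_mono: "k \<le> l \<Longrightarrow> past k \<subseteq> past l"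
  by (auto simp: past_def split: source.splits)

lemma past_drawn: "past k \<subseteq> drawn k"
  by (auto simp: drawn_def)

lemma fresh_past: "Sample i j (Suc k) \<notin> past k" "Seed i k \<notin> drawn k" "Coin k \<notin> drawn k" "Coin k \<notin> past k"
  by (auto simp: past_def drawn_def)

lemma batch_mean_info:
  assumes X: "X \<in> borel_measurable (info S)" and S: "S \<inter> {Sample i j k |i j. True} = {}"
  shows "(\<lambda>w. batch_mean k (X w) w) \<in> borel_measurable (info (S \<union> {Sample i j k |i j. True}))"
proof -
  note [measurable] = minibatch_error(1)[OF X S]
  have [measurable]: "X \<in> borel_measurable (info (S \<union> {Sample i j k |i j. True}))"
    by (rule measurable_info_mono[OF X]) simp
  have "(\<lambda>w. ((1 / real n) *\<^sub>R (\<Sum>i=1..n. minibatch_grad F (I i k) (\<lambda>j. \<xi> i j k w) (X w)) - grad f (X w)) + grad f (X w))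
      \<in> borel_measurable (info (S \<union> {Sample i j k |i j. True}))"
    by measurable
  then show ?thesis
    by (simp add: batch_mean_def)
qed

lemma dt_info:
  assumes x: "x k \<in> borel_measurable (info (past k))" and x': "x (Suc k) \<in> borel_measurable (info (past k))"
    and i: "i \<in> {1..n}" and S: "past k \<subseteq> S" "\<And>j. Sample i j (Suc k) \<in> S"
  shows "dt_noise i k \<in> borel_measurable (info S)" "dt i k \<in> borel_measurable (info S)"
proof -
  have [measurable]: "x k \<in> borel_measurable (info S)" "x (Suc k) \<in> borel_measurable (info S)"
    by (rule measurable_info_mono[OF x S(1)]) (rule measurable_info_mono[OF x' S(1)])
  have [measurable]: "(\<lambda>w. noise i (x (Suc k) w) (\<xi> i j (Suc k) w)) \<in> borel_measurable (info S)"
      "(\<lambda>w. noise i (x k w) (\<xi> i j (Suc k) w)) \<in> borel_measurable (info S)" if "j \<in> I' i (Suc k)" for j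
    using that by (auto intro!: noise_info[OF i _ S(2)])
  have "(\<lambda>w. (1 / real b') *\<^sub>R (\<Sum>j\<in>I' i (Suc k).
      noise i (x (Suc k) w) (\<xi> i j (Suc k) w) - noise i (x k w) (\<xi> i j (Suc k) w))) \<in> borel_measurable (info S)"
    by measurable
  then show *[measurable]: "dt_noise i k \<in> borel_measurable (info S)"
    using dt_noise_eq[OF _ i] by (subst measurable_cong) auto
  note [measurable] = grad_fi_measurable[OF i]
  have "(\<lambda>w. dt_noise i k w + (grad (fi i) (x (Suc k) w) - grad (fi i) (x k w))) \<in> borel_measurable (info S)"
    by measurable
  then show "dt i k \<in> borel_measurable (info S)"
    by (simp add: dt_noise_def dgrad_def)
qed

lemma x_Suc_info:
  assumes "x k \<in> borel_measurable (info S)" "g k \<in> borel_measurable (info S)"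
  shows "x (Suc k) \<in> borel_measurable (info S)"
proof -
  have "(\<lambda>w. x k w - \<gamma> *\<^sub>R g k w) \<in> borel_measurable (info S)"
    using assms by measurable
  then show ?thesis
    using x_Suc by (subst measurable_cong) auto
qed

lemma iterates_info: "x k \<in> borel_measurable (info (past k)) \<and> g k \<in> borel_measurable (info (past k))"
proof (induction k)
  case 0
  have "(\<lambda>w. batch_mean 0 x0 w) \<in> borel_measurable (info ({} \<union> {Sample i j 0 |i j. True}))"
    by (rule batch_mean_info) simp_all
  then have "g 0 \<in> borel_measurable (info ({} \<union> {Sample i j 0 |i j. True}))"
    using g_0 by (subst measurable_cong) auto
  then have "g 0 \<in> borel_measurable (info (past 0))"
    by (rule measurable_info_mono) (auto simp: past_def)
  moreover have "x 0 \<in> borel_measurable (info (past 0))"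
    using x_0 by (subst measurable_cong[of _ _ "\<lambda>_. x0"]) auto
  ultimately show ?case
    by simp
next
  case (Suc k)
  \<comment> \<open>The new point is fixed before iteration k draws anything, which makes its batch
    fresh.\<close>
  have x': "x (Suc k) \<in> borel_measurable (info (past k))"
    using Suc by (intro x_Suc_info) auto
  have [measurable]: "x (Suc k) \<in> borel_measurable (info (past (Suc k)))" "g k \<in> borel_measurable (info (past (Suc k)))"
    by (rule measurable_info_mono[OF x' past_mono] measurable_info_mono[OF conjunct2[OF Suc] past_mono], simp)+
  have [measurable]: "Measurable.pred (info (past (Suc k))) (c k)"
    by (rule coin(1)) (simp add: past_def)
  have [measurable]: "(\<lambda>w. Q (r i k w) (dt i k w)) \<in> borel_measurable (info (past (Suc k)))" if "i \<in> {1..n}" for i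
    using that Suc x' past_mono[of k "Suc k"]
    by (intro Q_info dt_info(2)) (auto simp: past_def)
  have [measurable]: "(\<lambda>w. batch_mean (Suc k) (x (Suc k) w) w) \<in> borel_measurable (info (past (Suc k)))"
    by (rule measurable_info_mono[OF batch_mean_info[OF x']]) (auto simp: past_def split: source.splits)
  have "(\<lambda>w. if c k w then batch_mean (Suc k) (x (Suc k) w) w
     else g k w + (1 / real n) *\<^sub>R (\<Sum>i=1..n. Q (r i k w) (dt i k w))) \<in> borel_measurable (info (past (Suc k)))"
    by measurable
  then have "g (Suc k) \<in> borel_measurable (info (past (Suc k)))"
    using g_Suc by (subst measurable_cong) auto
  then show ?case
    by simp
qed

lemma info_measurable:
  shows x_info: "past k \<subseteq> S \<Longrightarrow> x k \<in> borel_measurable (info S)"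
    and g_info: "past k \<subseteq> S \<Longrightarrow> g k \<in> borel_measurable (info S)"
    and x'_info: "past k \<subseteq> S \<Longrightarrow> x (Suc k) \<in> borel_measurable (info S)"
    and err_info: "past k \<subseteq> S \<Longrightarrow> err k \<in> borel_measurable (info S)"
    and dgrad_info: "i \<in> {1..n} \<Longrightarrow> past k \<subseteq> S \<Longrightarrow> dgrad i k \<in> borel_measurable (info S)"
proof -
  assume S: "past k \<subseteq> S"
  show [measurable]: "x k \<in> borel_measurable (info S)" "g k \<in> borel_measurable (info S)"
    using iterates_info[of k] S by (auto intro: measurable_info_mono)
  show [measurable]: "x (Suc k) \<in> borel_measurable (info S)"
    by (rule x_Suc_info) measurable
  show "err k \<in> borel_measurable (info S)"
    unfolding err_def[abs_def] by measurable
  show "dgrad i k \<in> borel_measurable (info S)" if "i \<in> {1..n}"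
    unfolding dgrad_def[abs_def] using grad_fi_measurable[OF that] by measurable
qed

lemma x_measurable [measurable]: "x k \<in> borel_measurable M"
  by (rule measurable_info[OF x_info[OF order_refl]])

lemma noise_info':
  assumes "i \<in> {1..n}"
  shows "drawn k \<subseteq> S \<Longrightarrow> dt_noise i k \<in> borel_measurable (info S)"
    and "drawn k \<subseteq> S \<Longrightarrow> dt i k \<in> borel_measurable (info S)"
    and "drawn k \<union> {Seed i k} \<subseteq> S \<Longrightarrow> Q_noise i k \<in> borel_measurable (info S)"
proof -
  assume S: "drawn k \<subseteq> S"
  then have "past k \<subseteq> S" "Sample i j (Suc k) \<in> S" for j
    by (auto simp: drawn_def)
  then show "dt_noise i k \<in> borel_measurable (info S)" "dt i k \<in> borel_measurable (info S)"
    using dt_info[OF x_info x'_info assms] by auto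
next
  assume S: "drawn k \<union> {Seed i k} \<subseteq> S"
  then have "past k \<subseteq> S" "Sample i j (Suc k) \<in> S" for j
    by (auto simp: drawn_def)
  then have [measurable]: "dt i k \<in> borel_measurable (info S)"
    using dt_info[OF x_info x'_info assms] by auto
  have [measurable]: "(\<lambda>w. Q (r i k w) (dt i k w)) \<in> borel_measurable (info S)"
    using S by (intro Q_info assms) auto
  show "Q_noise i k \<in> borel_measurable (info S)"
    unfolding Q_noise_def[abs_def] by measurable
qed

subsection \<open>Second moments\<close>

text \<open>The constant B of the error recursion. Sampling noise counts \<open>1 + \<omega>\<close>
  times: once directly, and \<open>\<omega>\<close> times through the quantization of a vector that
  contains it.\<close>

definition step_const :: real where
  "step_const = (1 / real n) * (\<omega> * ((1 / real n) * (\<Sum>i=1..n. (Li i)\<^sup>2))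
     + (1 + \<omega>) * ((1 / real n) * (\<Sum>i=1..n. (\<L>i i)\<^sup>2)) / real b')"

definition batch_var :: real where
  "batch_var = (1 / real n) * (\<Sum>i=1..n. (\<sigma>i i)\<^sup>2) / (real n * real b)"

lemma square_integrable_const: "square_integrable M (\<lambda>_. z :: 'e::euclidean_space)"
  by (simp add: square_integrable_def)

lemma square_integrable_grad_fi:
  assumes i: "i \<in> {1..n}" and X: "square_integrable M X"
  shows "square_integrable M (\<lambda>w. grad (fi i) (X w))"
proof -
  note [measurable] = grad_fi_measurable[OF i] square_integrableD(1)[OF X]
  have "square_integrable M (\<lambda>w. grad (fi i) (X w) - grad (fi i) 0)"
  proof (rule square_integrable_norm_le[OF X])
    show "norm (grad (fi i) (X w) - grad (fi i) 0) \<le> Li i * norm (X w)" for w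
      using smooth[OF i] unfolding smooth_with_def by (metis diff_zero)
  qed measurable
  from square_integrable_add[OF this square_integrable_const[of "grad (fi i) 0"]] show ?thesis
    by simp
qed

lemma square_integrable_grad_f:
  assumes "square_integrable M X"
  shows "square_integrable M (\<lambda>w. grad f (X w))"
  unfolding grad_f
  by (intro square_integrable_scaleR square_integrable_sum square_integrable_grad_fi assms)

lemma square_integrable_x_Suc:
  assumes "square_integrable M (x k)" "square_integrable M (err k)"
  shows "square_integrable M (x (Suc k))"
proof -
  have "square_integrable M (\<lambda>w. x k w - \<gamma> *\<^sub>R (err k w + grad f (x k w)))"
    using assms by (intro square_integrable_diff square_integrable_scaleR square_integrable_add
        square_integrable_grad_f)
  then show ?thesis
    using x_Suc by (subst square_integrable_cong) (auto simp: err_def)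
qed

lemma dgrad_bound:
  assumes i: "i \<in> {1..n}" and dx: "square_integrable M (dx k)"
  shows "square_integrable M (dgrad i k)" and "mean_sq M (dgrad i k) \<le> (Li i)\<^sup>2 * mean_sq M (dx k)"
proof -
  have le: "norm (dgrad i k w) \<le> Li i * norm (dx k w)" for w
    using smooth[OF i] by (simp add: smooth_with_def dgrad_def dx_def)
  have meas: "dgrad i k \<in> borel_measurable M"
    by (rule measurable_info[OF dgrad_info[OF i order_refl]])
  show *: "square_integrable M (dgrad i k)"
    by (rule square_integrable_norm_le[OF dx meas le])
  show "mean_sq M (dgrad i k) \<le> (Li i)\<^sup>2 * mean_sq M (dx k)"
    by (rule mean_sq_le[OF dx * le])
qed

text \<open>The bound must be proportional to the squared step, which an estimate through
  \<open>\<sigma>i\<close> alone would not give. Average smoothness supplies it conditionally, and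
  taking expectations removes the conditioning.\<close>

lemma dt_noise_bound:
  assumes i: "i \<in> {1..n}" and dx: "square_integrable M (dx k)"
  shows "square_integrable M (dt_noise i k)"
    and "mean_sq M (dt_noise i k) \<le> (\<L>i i)\<^sup>2 / real b' * mean_sq M (dx k)"
proof -
  let ?G = "two_point_sigma M x k"
  let ?N = "\<lambda>w. ennreal ((norm (dt_noise i k w))\<^sup>2)"
  have "sets ?G \<subseteq> events"
    unfolding two_point_sigma_def by (rule sets_image_in_sets) simp_all
  then have "subalgebra M ?G"
    by (simp add: subalgebra_def two_point_sigma_def)
  then interpret G: finite_measure_subalgebra M ?G
    by unfold_locales
  have meas: "dt_noise i k \<in> borel_measurable M"
    by (rule measurable_info[OF noise_info'(1)[OF i order_refl]])
  \<comment> \<open>The tower property, as the defining identity of the conditional expectation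
    tested against the constant 1.\<close>
  have "(\<integral>\<^sup>+w. ?N w \<partial>M) = (\<integral>\<^sup>+w. 1 * nn_cond_exp M ?G ?N w \<partial>M)"
    using meas by (subst G.nn_cond_exp_intg) auto
  also have "\<dots> \<le> (\<integral>\<^sup>+w. ennreal ((\<L>i i)\<^sup>2 / real b' * (norm (dx k w))\<^sup>2) \<partial>M)"
    using avg_smooth[OF i] unfolding average_smooth_def Let_def
    by (intro nn_integral_mono_AE) (simp add: dt_noise_def[abs_def] dgrad_def dx_def)
  also have "\<dots> = ennreal ((\<L>i i)\<^sup>2 / real b' * mean_sq M (dx k))"
    using square_integrableD(2)[OF dx] by (subst nn_integral_eq_integral) (simp_all add: mean_sq_def)
  finally have le: "(\<integral>\<^sup>+w. ?N w \<partial>M) \<le> ennreal ((\<L>i i)\<^sup>2 / real b' * mean_sq M (dx k))" .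
  show "square_integrable M (dt_noise i k)"
    "mean_sq M (dt_noise i k) \<le> (\<L>i i)\<^sup>2 / real b' * mean_sq M (dx k)"
    using square_integrableI_nn[OF meas le] by (simp_all add: mean_sq_nonneg)
qed

text \<open>Both evaluation points are known from \<open>past k\<close>, and the samples of worker i
  are fresh. S may contain the same batch of other workers, which yields orthogonality between
  workers.\<close>

lemma dt_noise_orth:
  assumes i: "i \<in> {1..n}" and U: "U \<in> borel_measurable (info S)" "square_integrable M U"
    and S: "past k \<subseteq> S" "\<And>j. Sample i j (Suc k) \<notin> S"
  shows "orth M U (dt_noise i k)"
proof -
  have "orth M U (\<lambda>w. (1 / real b') *\<^sub>R (\<Sum>j\<in>I' i (Suc k).
      noise i (x (Suc k) w) (\<xi> i j (Suc k) w) - noise i (x k w) (\<xi> i j (Suc k) w)))"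
    using x_info[OF S(1)] x'_info[OF S(1)] S(2)
    by (intro orth_scaleR orth_sum orth_diff square_integrable_diff noise_orth[OF i _ _ _ U]
          noise_bound(1)[OF i] U(2)) auto
  moreover have "(LINT w|M. U w \<bullet> dt_noise i k w) = (LINT w|M. U w \<bullet> ((1 / real b') *\<^sub>R (\<Sum>j\<in>I' i (Suc k).
      noise i (x (Suc k) w) (\<xi> i j (Suc k) w) - noise i (x k w) (\<xi> i j (Suc k) w))))"
    using dt_noise_eq[OF _ i] by (intro Bochner_Integration.integral_cong) auto
  ultimately show ?thesis
    by (simp add: orth_def)
qed

text \<open>An exact Pythagorean identity; a triangle inequality at this place would double the
  constants under the root in the stepsize.\<close>

lemma dt_bound:
  assumes i: "i \<in> {1..n}" and dx: "square_integrable M (dx k)"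
  shows "square_integrable M (dt i k)"
    and "mean_sq M (dt i k) = mean_sq M (dgrad i k) + mean_sq M (dt_noise i k)"
proof -
  have dt: "dt i k = (\<lambda>w. dgrad i k w + dt_noise i k w)"
    by (auto simp: dt_noise_def)
  note sq = dgrad_bound(1)[OF i dx] dt_noise_bound(1)[OF i dx]
  have "orth M (dgrad i k) (dt_noise i k)"
    by (rule dt_noise_orth[OF i dgrad_info[OF i order_refl] sq(1) order_refl fresh_past(1)])
  then show "mean_sq M (dt i k) = mean_sq M (dgrad i k) + mean_sq M (dt_noise i k)"
    unfolding dt by (rule mean_sq_add_orth[OF sq])
  show "square_integrable M (dt i k)"
    unfolding dt by (rule square_integrable_add[OF sq])
qed

lemma \<omega>_pos: "0 < \<omega>"
  using Q by (simp add: quantization_def)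

lemma Q_noise_bound:
  assumes i: "i \<in> {1..n}" and dx: "square_integrable M (dx k)"
  shows "square_integrable M (Q_noise i k)"
    and "mean_sq M (dt_noise i k) + mean_sq M (Q_noise i k)
      \<le> (\<omega> * (Li i)\<^sup>2 + (1 + \<omega>) * (\<L>i i)\<^sup>2 / real b') * mean_sq M (dx k)"
proof -
  note q = Q_bound[OF i noise_info'(2)[OF i order_refl] dt_bound(1)[OF i dx] fresh_past(2)]
  show "square_integrable M (Q_noise i k)"
    using q(1) by (simp add: Q_noise_def[abs_def])
  have "mean_sq M (dt_noise i k) + mean_sq M (Q_noise i k)
      \<le> mean_sq M (dt_noise i k) + \<omega> * (mean_sq M (dgrad i k) + mean_sq M (dt_noise i k))"
    using q(2) dt_bound(2)[OF i dx] by (simp add: Q_noise_def[abs_def])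
  also have "\<dots> = \<omega> * mean_sq M (dgrad i k) + (1 + \<omega>) * mean_sq M (dt_noise i k)"
    by (simp add: algebra_simps)
  also have "\<dots> \<le> \<omega> * ((Li i)\<^sup>2 * mean_sq M (dx k)) + (1 + \<omega>) * ((\<L>i i)\<^sup>2 / real b' * mean_sq M (dx k))"
    using \<omega>_pos dgrad_bound(2)[OF i dx] dt_noise_bound(2)[OF i dx]
    by (intro add_mono mult_left_mono) auto
  finally show "mean_sq M (dt_noise i k) + mean_sq M (Q_noise i k)
      \<le> (\<omega> * (Li i)\<^sup>2 + (1 + \<omega>) * (\<L>i i)\<^sup>2 / real b') * mean_sq M (dx k)"
    by (simp add: algebra_simps)
qed

lemma Q_noise_orth:
  assumes i: "i \<in> {1..n}" and dx: "square_integrable M (dx k)"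
    and U: "U \<in> borel_measurable (info S)" "square_integrable M U"
    and S: "drawn k \<subseteq> S" "Seed i k \<notin> S"
  shows "orth M U (Q_noise i k)"
  using Q_orth[OF i noise_info'(2)[OF i S(1)] dt_bound(1)[OF i dx] S(2) U]
  by (simp add: Q_noise_def[abs_def])

section \<open>One step of the error recursion\<close>

definition quantized_err :: "nat \<Rightarrow> 'w \<Rightarrow> real ^ 'd" where
  "quantized_err k w = err k w + ((1 / real n) *\<^sub>R (\<Sum>i=1..n. dt_noise i k w)
     + (1 / real n) *\<^sub>R (\<Sum>i=1..n. Q_noise i k w))"

text \<open>The terms are revealed in the order old error, sampling noise, quantization noise, and
  each is centred given those before it. Since the noises of different workers are orthogonal too,
  the squared weight 1 / n leaves a gain of 1 / n after summing over the workers.\<close>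

lemma quantized_err_bound:
  assumes err: "square_integrable M (err k)" and dx: "square_integrable M (dx k)"
  shows "square_integrable M (quantized_err k)"
    and "mean_sq M (quantized_err k) \<le> mean_sq M (err k) + step_const * mean_sq M (dx k)"
proof -
  define V where "V w = (1 / real n) *\<^sub>R (\<Sum>i=1..n. dt_noise i k w)" for w
  define W where "W w = (1 / real n) *\<^sub>R (\<Sum>i=1..n. Q_noise i k w)" for w
  have eq: "quantized_err k = (\<lambda>w. err k w + (V w + W w))"
    by (auto simp: quantized_err_def V_def W_def)
  note sq = dt_noise_bound(1)[OF _ dx] Q_noise_bound(1)[OF _ dx]
  have V: "square_integrable M V" and W: "square_integrable M W"
    unfolding V_def[abs_def] W_def[abs_def]
    by (auto intro!: square_integrable_scaleR square_integrable_sum sq)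
  have err_dt: "orth M (err k) V"
    unfolding V_def[abs_def]
    by (intro orth_scaleR orth_sum err sq dt_noise_orth[OF _ err_info[OF order_refl]] order_refl fresh_past)
  have V_info: "V \<in> borel_measurable (info (drawn k))"
    unfolding V_def[abs_def] by (auto intro!: borel_measurable_scaleR borel_measurable_sum noise_info'(1))
  have err_Q: "orth M (err k) W"
    unfolding W_def[abs_def]
    by (intro orth_scaleR orth_sum err sq Q_noise_orth[OF _ dx err_info[OF past_drawn]] order_refl fresh_past)
  have dt_Q: "orth M V W"
    unfolding W_def[abs_def]
    by (intro orth_scaleR orth_sum V sq Q_noise_orth[OF _ dx V_info] order_refl fresh_past)
  have "mean_sq M V = (1 / real n)\<^sup>2 * (\<Sum>i=1..n. mean_sq M (dt_noise i k))"
    unfolding V_def[abs_def] mean_sq_scaleR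
  proof (subst mean_sq_sum_orth)
    fix i j assume ij: "i \<in> {1..n}" "j \<in> {1..n}" "i \<noteq> j"
    \<comment> \<open>Contains the batch of worker i but no sample of worker j from it, so the noise
      of i is known while that of j is still fresh.\<close>
    define S where "S = past k \<union> {Sample i l (Suc k) |l. True}"
    have "dt_noise i k \<in> borel_measurable (info S)"
      by (rule dt_info[OF x_info x'_info ij(1)]) (auto simp: S_def)
    then show "orth M (dt_noise i k) (dt_noise j k)"
      using ij fresh_past by (intro dt_noise_orth sq) (auto simp: S_def)
  qed (auto intro: sq)
  moreover have "mean_sq M W = (1 / real n)\<^sup>2 * (\<Sum>i=1..n. mean_sq M (Q_noise i k))"
    unfolding W_def[abs_def] mean_sq_scaleR
  proof (subst mean_sq_sum_orth)
    fix i j assume ij: "i \<in> {1..n}" "j \<in> {1..n}" "i \<noteq> j"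
    then show "orth M (Q_noise i k) (Q_noise j k)"
      using fresh_past by (intro Q_noise_orth[OF _ dx noise_info'(3)[OF _ order_refl]] sq) auto
  qed (auto intro: sq)
  moreover have "mean_sq M (quantized_err k) = mean_sq M (err k) + (mean_sq M V + mean_sq M W)"
    unfolding eq mean_sq_add_orth[OF V W dt_Q, symmetric]
    by (intro mean_sq_add_orth orth_add square_integrable_add err V W err_dt err_Q)
  ultimately have "mean_sq M (quantized_err k)
      = mean_sq M (err k) + (1 / real n)\<^sup>2 * (\<Sum>i=1..n. mean_sq M (dt_noise i k) + mean_sq M (Q_noise i k))"
    by (simp add: sum.distrib distrib_left)
  also have "\<dots> \<le> mean_sq M (err k) + (1 / real n)\<^sup>2 *
      (\<Sum>i=1..n. (\<omega> * (Li i)\<^sup>2 + (1 + \<omega>) * (\<L>i i)\<^sup>2 / real b') * mean_sq M (dx k))"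
    by (intro add_left_mono mult_left_mono sum_mono Q_noise_bound(2) dx) auto
  also have "(\<Sum>i=1..n. (\<omega> * (Li i)\<^sup>2 + (1 + \<omega>) * (\<L>i i)\<^sup>2 / real b') * mean_sq M (dx k))
      = (\<omega> * (\<Sum>i=1..n. (Li i)\<^sup>2) + (1 + \<omega>) * (\<Sum>i=1..n. (\<L>i i)\<^sup>2) / real b') * mean_sq M (dx k)"
    by (simp add: sum.distrib sum_distrib_left sum_divide_distrib flip: sum_distrib_right)
  also have "(1 / real n)\<^sup>2 * \<dots> = step_const * mean_sq M (dx k)"
    using n batches(1) by (simp add: step_const_def power2_eq_square field_simps)
  finally show "mean_sq M (quantized_err k) \<le> mean_sq M (err k) + step_const * mean_sq M (dx k)" .
  show "square_integrable M (quantized_err k)"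
    unfolding eq by (intro square_integrable_add err V W)
qed

lemma err_step:
  assumes x: "square_integrable M (x k)" and err: "square_integrable M (err k)"
  shows "square_integrable M (dx k)" and "square_integrable M (err (Suc k))"
    and "mean_sq M (err (Suc k))
      \<le> (1 - p) * (mean_sq M (err k) + step_const * mean_sq M (dx k)) + p * batch_var"
proof -
  define A where "A w = batch_mean (Suc k) (x (Suc k) w) w - grad f (x (Suc k) w)" for w
  let ?B = "quantized_err k"
  show dx: "square_integrable M (dx k)"
    unfolding dx_def[abs_def] by (intro square_integrable_diff square_integrable_x_Suc x err)
  have disj: "past k \<inter> {Sample i j (Suc k) |i j. True} = {}"
    using fresh_past(1) by auto
  have A: "A \<in> borel_measurable (info (drawn k))" "square_integrable M A" "mean_sq M A \<le> batch_var"
    unfolding A_def[abs_def] batch_mean_def drawn_def batch_var_def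
    by (rule minibatch_error[OF x'_info[OF order_refl] disj])+
  note B = quantized_err_bound[OF err dx]
  \<comment> \<open>Both candidate errors are defined whatever the coin shows and use only other
    sources, so the coin can be averaged out independently of them.\<close>
  define S where "S = - {Coin k}"
  have "drawn k \<union> {Seed i k} \<subseteq> S" "drawn k \<subseteq> S" "past k \<subseteq> S" for i
    using fresh_past past_drawn by (auto simp: S_def)
  then have [measurable]: "A \<in> borel_measurable (info S)" "?B \<in> borel_measurable (info S)"
    unfolding quantized_err_def[abs_def]
    by (auto intro!: borel_measurable_add borel_measurable_scaleR borel_measurable_sum err_info noise_info'
        measurable_info_mono[OF A(1)])
  have coin_k: "c k \<in> measurable (info {Coin k}) (count_space UNIV)"
    by (rule coin(1)) simp
  have "(\<lambda>w. (norm (A w))\<^sup>2) \<in> borel_measurable (info S)" "(\<lambda>w. (norm (?B w))\<^sup>2) \<in> borel_measurable (info S)"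
    by measurable
  note cA = integral_coin_mult(1,2)[OF coin_k coin(2) p01 this(1) square_integrableD(2)[OF A(2)]]
    and cB = integral_coin_mult(3,4)[OF coin_k coin(2) p01 this(2) square_integrableD(2)[OF B(1)]]
  have S_coin: "S \<inter> {Coin k} = {}"
    by (simp add: S_def)
  have eq: "(norm (err (Suc k) w))\<^sup>2
      = (if c k w then (norm (A w))\<^sup>2 else 0) + (if c k w then 0 else (norm (?B w))\<^sup>2)"
    if "w \<in> space M" for w
    unfolding err_Suc[OF that] A_def quantized_err_def by simp
  have "err (Suc k) \<in> borel_measurable M"
    by (rule measurable_info[OF err_info[OF order_refl]])
  moreover have "integrable M (\<lambda>w. (norm (err (Suc k) w))\<^sup>2)"
    using cA(1)[OF S_coin] cB(1)[OF S_coin] eq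
    by (subst Bochner_Integration.integrable_cong[OF refl eq]) auto
  ultimately show "square_integrable M (err (Suc k))"
    by (simp add: square_integrable_def)
  have "mean_sq M (err (Suc k)) = p * mean_sq M A + (1 - p) * mean_sq M ?B"
    unfolding mean_sq_def using cA[OF S_coin] cB[OF S_coin]
    by (subst Bochner_Integration.integral_cong[OF refl eq]) auto
  also have "\<dots> \<le> p * batch_var + (1 - p) * (mean_sq M (err k) + step_const * mean_sq M (dx k))"
    using p01 A(3) B(2) by (intro add_mono mult_left_mono) auto
  finally show "mean_sq M (err (Suc k))
      \<le> (1 - p) * (mean_sq M (err k) + step_const * mean_sq M (dx k)) + p * batch_var"
    by simp
qed

lemma err_0: "square_integrable M (err 0)" "mean_sq M (err 0) \<le> batch_var"
proof -
  note A = minibatch_error(2,3)[of "\<lambda>_. x0" "{}" 0]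
  have eq: "err 0 w = (1 / real n) *\<^sub>R (\<Sum>i=1..n. minibatch_grad F (I i 0) (\<lambda>j. \<xi> i j 0 w) x0) - grad f x0"
    if "w \<in> space M" for w
    using g_0[OF that] x_0[OF that] by (simp add: err_def batch_mean_def)
  show "square_integrable M (err 0)"
    by (subst square_integrable_cong[OF eq]) (use A in auto)
  show "mean_sq M (err 0) \<le> batch_var"
    unfolding batch_var_def by (subst mean_sq_cong[OF eq]) (use A in auto)
qed

lemma iterates_square_integrable: "square_integrable M (x k)" "square_integrable M (err k)"
proof -
  have "square_integrable M (x k) \<and> square_integrable M (err k)"
  proof (induction k)
    case 0
    have "square_integrable M (x 0)"
      by (subst square_integrable_cong[of _ _ "\<lambda>_. x0"]) (simp_all add: x_0 square_integrable_const)
    with err_0 show ?case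
      by simp
  next
    case (Suc k)
    then show ?case
      using square_integrable_x_Suc err_step(2) by simp
  qed
  then show "square_integrable M (x k)" "square_integrable M (err k)"
    by simp_all
qed

text \<open>Integrability of the gap needs no growth estimate for f: the next gap is nonnegative and
  dominated by the integrable right-hand side, so it propagates from the constant initial
  gap.\<close>

lemma E_descent:
  assumes L: "smooth_with L f" and PL: "\<And>z. (norm (grad f z))\<^sup>2 \<ge> 2 * \<mu> * (f z - f xstar)"
    and "\<gamma> > 0" and min: "\<And>z. f xstar \<le> f z"
  shows "integrable M (\<lambda>w. f (x k w) - f xstar)"
    and "(LINT w|M. f (x (Suc k) w) - f xstar) \<le> (1 - \<gamma> * \<mu>) * (LINT w|M. f (x k w) - f xstar)
      - (1 / (2 * \<gamma>) - L / 2) * mean_sq M (dx k) + \<gamma> / 2 * mean_sq M (err k)"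
proof -
  define rhs where "rhs k w = (1 - \<gamma> * \<mu>) * (f (x k w) - f xstar)
      - (1 / (2 * \<gamma>) - L / 2) * (norm (dx k w))\<^sup>2 + \<gamma> / 2 * (norm (err k w))\<^sup>2" for k w
  have le: "f (x (Suc k) w) - f xstar \<le> rhs k w" if "w \<in> space M" for k w
    unfolding rhs_def dx_def err_def
    by (rule gradient_step_PL[OF L PL \<open>\<gamma> > 0\<close> x_Suc[OF that]])
  note int = square_integrableD(2)[OF err_step(1)[OF iterates_square_integrable]]
    square_integrableD(2)[OF iterates_square_integrable(2)]
  have [measurable]: "f \<in> borel_measurable borel"
    using L by (rule borel_measurable_smooth)
  have *: "integrable M (\<lambda>w. f (x k w) - f xstar)" for k
  proof (induction k)
    case 0
    show ?case
      by (subst Bochner_Integration.integrable_cong[OF refl, of _ _ "\<lambda>_. f x0 - f xstar"]) (auto simp: x_0)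
  next
    case (Suc k)
    have "integrable M (rhs k)"
      unfolding rhs_def[abs_def] using Suc int by simp
    then show ?case
    proof (rule Bochner_Integration.integrable_bound)
      show "AE w in M. norm (f (x (Suc k) w) - f xstar) \<le> norm (rhs k w)"
        using le[of _ k] min by (intro AE_I2) (smt (verit) real_norm_def)
    qed measurable
  qed
  then show "integrable M (\<lambda>w. f (x k w) - f xstar)" .
  have "(LINT w|M. f (x (Suc k) w) - f xstar) \<le> (LINT w|M. rhs k w)"
    using * int le by (intro integral_mono) (auto simp: rhs_def[abs_def])
  also have "\<dots> = (1 - \<gamma> * \<mu>) * (LINT w|M. f (x k w) - f xstar)
      - (1 / (2 * \<gamma>) - L / 2) * mean_sq M (dx k) + \<gamma> / 2 * mean_sq M (err k)"
    unfolding rhs_def mean_sq_def using *[of k] int[of k] by simp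
  finally show "(LINT w|M. f (x (Suc k) w) - f xstar) \<le> (1 - \<gamma> * \<mu>) * (LINT w|M. f (x k w) - f xstar)
      - (1 / (2 * \<gamma>) - L / 2) * mean_sq M (dx k) + \<gamma> / 2 * mean_sq M (err k)" .
qed

end

section \<open>Costs\<close>

lemma nnz_sum: "real (nnz y) = (\<Sum>l\<in>UNIV. if y $ l \<noteq> 0 then 1 else 0)"
  by (simp add: nnz_def sum.If_cases)

lemma nnz_le: "real (nnz (y :: real ^ 'd::finite)) \<le> real CARD('d)"
  unfolding nnz_def of_nat_le_iff by (rule card_mono) auto

lemma nnz_eq_0: "nnz y = 0 \<longleftrightarrow> y = 0"
  by (simp add: nnz_def vec_eq_iff)

lemma nnz_measurable [measurable]: "(\<lambda>y :: real ^ 'd::finite. real (nnz y)) \<in> borel_measurable borel"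
proof -
  have [measurable]: "(\<lambda>y :: real ^ 'd. y $ l) \<in> borel_measurable borel" for l
    by (intro borel_measurable_continuous_onI continuous_intros)
  show ?thesis
    unfolding nnz_sum by measurable
qed

lemma quantization_measurable:
  assumes "quantization R Q \<omega>"
  shows "(\<lambda>s. Q s z) \<in> borel_measurable R"
proof -
  have [measurable]: "(\<lambda>(s, z). Q s z) \<in> borel_measurable (R \<Otimes>\<^sub>M borel)"
    using assms by (simp add: quantization_def)
  have "(\<lambda>s. case (s, z) of (s, z) \<Rightarrow> Q s z) \<in> borel_measurable R"
    by measurable
  then show ?thesis
    by simp
qed

lemma nnz_integrable:
  fixes Q :: "'r \<Rightarrow> real ^ 'd \<Rightarrow> real ^ 'd::finite"
  assumes "quantization R Q \<omega>"
  shows "integrable R (\<lambda>s. real (nnz (Q s z)))"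
    and "(LINT s|R. real (nnz (Q s z))) \<le> real CARD('d)"
proof -
  interpret prob_space R
    using assms by (simp add: quantization_def)
  note [measurable] = quantization_measurable[OF assms]
  show int: "integrable R (\<lambda>s. real (nnz (Q s z)))"
    by (rule integrable_const_bound[where B = "real CARD('d)"]) (use nnz_le[where 'd = 'd] in auto)
  have "(LINT s|R. real (nnz (Q s z))) \<le> (LINT s|R. real CARD('d))"
    using int nnz_le by (intro integral_mono) auto
  then show "(LINT s|R. real (nnz (Q s z))) \<le> real CARD('d)"
    by (simp add: prob_space)
qed

text \<open>The supremum ranges over values bounded by the dimension, so it behaves as a genuine
  least upper bound. It is positive because an output that is almost surely 0 cannot be unbiased at
  a non-zero point.\<close>

lemma expected_density:
  fixes Q :: "'r \<Rightarrow> real ^ 'd \<Rightarrow> real ^ 'd::finite"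
  assumes Q: "quantization R Q \<omega>"
  shows expected_density_upper: "(LINT s|R. real (nnz (Q s z))) \<le> expected_density R Q"
    and expected_density_le: "expected_density R Q \<le> real CARD('d)"
    and expected_density_pos: "0 < expected_density R Q"
proof -
  have bdd: "bdd_above (range (\<lambda>z. LINT s|R. real (nnz (Q s z))))"
    using nnz_integrable(2)[OF Q] by (intro bdd_aboveI2)
  show upper: "(LINT s|R. real (nnz (Q s z))) \<le> expected_density R Q" for z
    unfolding expected_density_def by (rule cSUP_upper[OF UNIV_I bdd])
  show "expected_density R Q \<le> real CARD('d)"
    unfolding expected_density_def using nnz_integrable(2)[OF Q] by (intro cSUP_least) auto
  show "0 < expected_density R Q"
  proof (rule ccontr)
    assume "\<not> 0 < expected_density R Q"
    define z :: "real ^ 'd" where "z = (\<chi> l. 1)"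
    have "(LINT s|R. real (nnz (Q s z))) \<le> 0"
      using upper[of z] \<open>\<not> 0 < expected_density R Q\<close> by linarith
    then have "(LINT s|R. real (nnz (Q s z))) = 0"
      by (intro antisym integral_nonneg) auto
    then have "AE s in R. real (nnz (Q s z)) = 0"
      using nnz_integrable(1)[OF Q] by (subst (asm) integral_nonneg_eq_0_iff_AE) auto
    then have "(LINT s|R. Q s z) = (LINT s|R. 0)"
      using quantization_measurable[OF Q]
      by (intro integral_cong_AE) (auto simp: nnz_eq_0)
    moreover have "(LINT s|R. Q s z) = z"
      using Q by (auto simp: quantization_def)
    ultimately show False
      by (simp add: z_def vec_eq_iff)
  qed
qed

section \<open>Expected oracle calls and transmitted components of a run\<close>

context vr_marina
begin

text \<open>The density is a supremum over fixed points; the quantized vector is random but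
  independent of the seed, hence can be frozen.\<close>

lemma E_nnz_Q:
  assumes i: "i \<in> {1..n}"
  shows "integrable M (\<lambda>w. real (nnz (Q (r i k w) (dt i k w))))"
    and "(LINT w|M. real (nnz (Q (r i k w) (dt i k w)))) \<le> expected_density R Q"
proof -
  have dt: "dt i k \<in> borel_measurable (info (drawn k))"
    by (rule noise_info'(2)[OF i order_refl])
  have r: "r i k \<in> measurable (info {Seed i k}) R"
    by (rule seed(1)[OF i]) simp
  have h: "(\<lambda>(z, s). ennreal (real (nnz (Q s z)))) \<in> borel_measurable (borel \<Otimes>\<^sub>M R)"
    using Q_measurable by measurable
  have "(\<lambda>w. Q (r i k w) (dt i k w)) \<in> borel_measurable (info UNIV)"
    by (rule Q_info[OF i]) (auto intro: noise_info'(2)[OF i])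
  then have [measurable]: "(\<lambda>w. Q (r i k w) (dt i k w)) \<in> borel_measurable M"
    by (rule measurable_info)
  show int: "integrable M (\<lambda>w. real (nnz (Q (r i k w) (dt i k w))))"
    by (rule integrable_const_bound[where B = "real CARD('d)"]) (use nnz_le[where 'd = 'd] in auto)
  have "ennreal (LINT w|M. real (nnz (Q (r i k w) (dt i k w))))
      = (\<integral>\<^sup>+w. ennreal (real (nnz (Q (r i k w) (dt i k w)))) \<partial>M)"
    using int by (intro nn_integral_eq_integral[symmetric]) auto
  also have "\<dots> = (\<integral>\<^sup>+w. (\<integral>\<^sup>+s. ennreal (real (nnz (Q s (dt i k w)))) \<partial>R) \<partial>M)"
    using nn_integral_fresh[OF dt r _ seed(2)[OF i] h] fresh_past(2) by simp
  also have "\<dots> \<le> (\<integral>\<^sup>+w. ennreal (expected_density R Q) \<partial>M)"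
  proof (rule nn_integral_mono)
    fix w
    have "(\<integral>\<^sup>+s. ennreal (real (nnz (Q s (dt i k w)))) \<partial>R) = ennreal (LINT s|R. real (nnz (Q s (dt i k w))))"
      by (intro nn_integral_eq_integral nnz_integrable[OF Q]) auto
    then show "(\<integral>\<^sup>+s. ennreal (real (nnz (Q s (dt i k w)))) \<partial>R) \<le> ennreal (expected_density R Q)"
      using expected_density_upper[OF Q] by (simp add: ennreal_leI)
  qed
  also have "\<dots> = ennreal (expected_density R Q)"
    by (simp add: emeasure_space_1)
  finally show "(LINT w|M. real (nnz (Q (r i k w) (dt i k w)))) \<le> expected_density R Q"
    using expected_density_pos[OF Q] by simp
qed

lemma coin_const:
  fixes z :: real
  shows "integrable M (\<lambda>w. if c k w then z else 0)" "(LINT w|M. (if c k w then z else 0)) = p * z"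
    and "integrable M (\<lambda>w. if c k w then 0 else z)" "(LINT w|M. (if c k w then 0 else z)) = (1 - p) * z"
proof -
  have coin_k: "c k \<in> measurable (info {Coin k}) (count_space UNIV)"
    by (rule coin(1)) simp
  show "integrable M (\<lambda>w. if c k w then z else 0)" "integrable M (\<lambda>w. if c k w then 0 else z)"
    by (rule integral_coin_mult(1,3)[OF coin_k coin(2) p01, of "\<lambda>_. z" "{}"]; simp)+
  show "(LINT w|M. (if c k w then z else 0)) = p * z" "(LINT w|M. (if c k w then 0 else z)) = (1 - p) * z"
    by (rule integral_coin_mult(2,4)[OF coin_k coin(2) p01, of "\<lambda>_. z" "{}", THEN trans]; simp add: prob_space)+
qed

lemma E_oracle_calls:
  assumes i: "i \<in> {1..n}"
  shows "(LINT w|M. real (oracle_calls I I' c i K w))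
    = real b + real K * (p * real b + (1 - p) * (2 * real b'))"
proof -
  let ?C = "\<lambda>k w. (if c k w then real b else 0) + (if c k w then 0 else 2 * real b')"
  have int: "integrable M (?C k)" and E: "(LINT w|M. ?C k w) = p * real b + (1 - p) * (2 * real b')" for k
    using coin_const(1,2)[of k "real b"] coin_const(3,4)[of k "2 * real b'"] by simp_all
  have "real (if c k w then card (I i (Suc k)) else 2 * card (I' i (Suc k))) = ?C k w" for k w
    using batches(3,4)[OF i] by simp
  then have "real (oracle_calls I I' c i K w) = real b + (\<Sum>k<K. ?C k w)" for w
    using batches(3)[OF i] by (simp only: oracle_calls_def of_nat_add of_nat_sum)
  then have "(LINT w|M. real (oracle_calls I I' c i K w)) = (LINT w|M. real b + (\<Sum>k<K. ?C k w))"
    by presburger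
  also have "\<dots> = (LINT w|M. real b) + (LINT w|M. (\<Sum>k<K. ?C k w))"
    by (intro Bochner_Integration.integral_add Bochner_Integration.integrable_sum int) simp
  also have "(LINT w|M. (\<Sum>k<K. ?C k w)) = (\<Sum>k<K. LINT w|M. ?C k w)"
    by (intro Bochner_Integration.integral_sum int)
  finally show ?thesis
    unfolding E by (simp add: prob_space)
qed

lemma E_sent_nonzeros:
  assumes i: "i \<in> {1..n}"
  shows "(LINT w|M. real (sent_nonzeros m i K w))
    \<le> real CARD('d) + real K * (p * real CARD('d) + (1 - p) * expected_density R Q)"
proof -
  let ?q = "\<lambda>k w. real (nnz (Q (r i k w) (dt i k w)))"
  let ?d = "real CARD('d)"
  have coin_k: "c k \<in> measurable (info {Coin k}) (count_space UNIV)" for k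
    by (rule coin(1)) simp
  have q_info: "?q k \<in> borel_measurable (info (drawn k \<union> {Seed i k}))" for k
    by (rule measurable_compose[OF Q_info[OF i _ noise_info'(2)[OF i]] nnz_measurable]) auto
  have "(drawn k \<union> {Seed i k}) \<inter> {Coin k} = {}" for k
    using fresh_past(3) by simp
  note cq = integral_coin_mult(3,4)[OF coin_k coin(2) p01 q_info E_nnz_Q(1)[OF i] this]
  let ?C = "\<lambda>k w. (if c k w then ?d else 0) + (if c k w then 0 else ?q k w)"
  have int: "integrable M (?C k)" and E: "(LINT w|M. ?C k w) = p * ?d + (1 - p) * (LINT w|M. ?q k w)" for k
    using coin_const(1,2)[of k "?d"] cq[of k] by simp_all
  \<comment> \<open>Unquantized messages are charged all d components. Only this majorant has to be
    integrable in the comparison: a non-integrable left side would have integral 0, and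
    \<open>B\<close> is nonnegative.\<close>
  define B where "B w = ?d + (\<Sum>k<K. ?C k w)" for w
  have "(LINT w|M. real (sent_nonzeros m i K w)) \<le> (LINT w|M. B w)"
  proof (rule integral_mono')
    show "integrable M B"
      unfolding B_def[abs_def]
      by (intro Bochner_Integration.integrable_add Bochner_Integration.integrable_sum int) simp
    fix w assume w: "w \<in> space M"
    show "0 \<le> B w"
      unfolding B_def by (intro add_nonneg_nonneg sum_nonneg) auto
    have "real (sent_nonzeros m i K w) = real (nnz (m i 0 w)) + (\<Sum>k<K. real (nnz (m i (Suc k) w)))"
      by (simp add: sent_nonzeros_def sum.atMost_shift)
    also have "\<dots> \<le> B w"
      unfolding B_def using m_Suc[OF w i] nnz_le[where 'd = 'd]
      by (intro add_mono sum_mono) auto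
    finally show "real (sent_nonzeros m i K w) \<le> B w" .
  qed
  also have "\<dots> = (LINT w|M. ?d) + (LINT w|M. (\<Sum>k<K. ?C k w))"
    unfolding B_def
    by (intro Bochner_Integration.integral_add Bochner_Integration.integrable_sum int) simp
  also have "(LINT w|M. (\<Sum>k<K. ?C k w)) = (\<Sum>k<K. LINT w|M. ?C k w)"
    by (intro Bochner_Integration.integral_sum int)
  also have "(LINT w|M. ?d) + \<dots> = ?d + (\<Sum>k<K. p * ?d + (1 - p) * (LINT w|M. ?q k w))"
    unfolding E by (simp add: prob_space)
  also have "\<dots> \<le> ?d + (\<Sum>k<K. p * ?d + (1 - p) * expected_density R Q)"
    using p01 by (intro add_mono sum_mono mult_left_mono E_nnz_Q(2)[OF i]) auto
  finally show ?thesis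
    by simp
qed

end

section \<open>Complexity\<close>

lemma iteration_count:
  fixes q \<epsilon> \<rho> \<Delta> :: real
  assumes q: "0 < q" "q \<le> 1 / 2" and \<epsilon>: "0 < \<epsilon>" and \<rho>: "1 < \<rho>" "\<rho> * \<epsilon> \<le> \<Delta>"
  obtains K :: nat where "real K \<le> 5 / 4 * (1 + 1 / ln \<rho>) * ln (\<Delta> / \<epsilon>) / q"
    and "(1 - q) ^ K * (\<Delta> + \<epsilon> / 6) \<le> 2 / 3 * \<epsilon>"
proof -
  have "\<rho> \<le> \<Delta> / \<epsilon>"
    using \<epsilon> \<rho> by (simp add: field_simps)
  then have ln_\<rho>: "0 < ln \<rho>" "ln \<rho> \<le> ln (\<Delta> / \<epsilon>)"
    using \<rho> by auto
  have "1 * \<epsilon> < \<rho> * \<epsilon>"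
    using \<rho>(1) \<epsilon> by (rule mult_strict_right_mono)
  then have \<Delta>: "\<epsilon> < \<Delta>"
    using \<rho>(2) by linarith
  \<comment> \<open>The factor 7/4 is fitted to the claim: as \<open>\<epsilon> < \<Delta>\<close>,
    the bracket is at most \<open>7 / 6 * \<Delta>\<close>, and 4/7 times 7/6 is 2/3.\<close>
  define a where "a = ln (7 / 4 * (\<Delta> / \<epsilon>))"
  define K where "K = nat \<lceil>a / q\<rceil>"
  have a_eq: "a = ln (7 / 4) + ln (\<Delta> / \<epsilon>)"
    using \<Delta> \<epsilon> unfolding a_def by (intro ln_mult_pos) auto
  have "ln (7 / 4 :: real) \<le> 7 / 4 - 1"
    by (rule ln_le_minus_one) simp
  then have a_le: "a \<le> 3 / 4 + ln (\<Delta> / \<epsilon>)"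
    using a_eq by simp
  have "0 \<le> ln (7 / 4 :: real)"
    by simp
  then have "0 \<le> a / q"
    using a_eq ln_\<rho> q by simp
  then have K: "a / q \<le> real K" "real K \<le> a / q + 1"
    unfolding K_def by linarith+
  \<comment> \<open>Rounding up costs 1, which is at most (1/2) / q. Together with ln (7/4) \<le>
    3/4 the additive constants make 5/4, absorbed by 5/4 times
    \<open>ln (\<Delta> / \<epsilon>) / ln \<rho>\<close>, a quotient that is at least 1.\<close>
  have "1 \<le> 1 / 2 / q"
    using q by (simp add: field_simps)
  then have "real K \<le> (a + 1 / 2) / q"
    using K(2) unfolding add_divide_distrib by linarith
  also have "\<dots> \<le> (5 / 4 * (1 + 1 / ln \<rho>) * ln (\<Delta> / \<epsilon>)) / q"
  proof (rule divide_right_mono)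
    have "1 \<le> ln (\<Delta> / \<epsilon>) / ln \<rho>"
      using ln_\<rho> by simp
    moreover have "(1 + 1 / ln \<rho>) * ln (\<Delta> / \<epsilon>) = ln (\<Delta> / \<epsilon>) + ln (\<Delta> / \<epsilon>) / ln \<rho>"
      by (simp add: distrib_right)
    moreover have "0 < ln (\<Delta> / \<epsilon>)"
      using ln_\<rho> by linarith
    ultimately show "a + 1 / 2 \<le> 5 / 4 * (1 + 1 / ln \<rho>) * ln (\<Delta> / \<epsilon>)"
      using a_le unfolding mult.assoc by linarith
  qed (use q in simp)
  finally have bound: "real K \<le> 5 / 4 * (1 + 1 / ln \<rho>) * ln (\<Delta> / \<epsilon>) / q" .
  have "(1 - q) ^ K \<le> exp (- q) ^ K"
    using q exp_ge_add_one_self[of "- q"] by (intro power_mono) auto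
  also have "\<dots> = exp (- (q * real K))"
    by (simp add: mult.commute flip: exp_of_nat_mult)
  also have "\<dots> \<le> exp (- a)"
    using K(1) q by (simp add: field_simps)
  also have "\<dots> = 4 / 7 * (\<epsilon> / \<Delta>)"
    using \<Delta> \<epsilon> unfolding a_def exp_minus by (subst exp_ln) auto
  finally have "(1 - q) ^ K * (\<Delta> + \<epsilon> / 6) \<le> 4 / 7 * (\<epsilon> / \<Delta>) * (7 / 6 * \<Delta>)"
    using \<Delta> \<epsilon> by (intro mult_mono) auto
  also have "\<dots> = 2 / 3 * \<epsilon>"
    using \<Delta> \<epsilon> by simp
  finally show ?thesis
    using that bound by blast
qed

text \<open>With t = \<open>sqrt a * \<gamma>\<close> the stepsize bound reads
  \<open>L * \<gamma> + t \<le> 1\<close>; hence t \<le> 1, and squaring t only decreases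
  it.\<close>

lemma stepsize_condition:
  fixes L a \<gamma> :: real
  assumes "0 < L" "0 \<le> a" "0 \<le> \<gamma>" "\<gamma> \<le> 1 / (L + sqrt a)"
  shows "a * \<gamma>\<^sup>2 + L * \<gamma> \<le> 1"
proof -
  define t where "t = sqrt a * \<gamma>"
  have t: "0 \<le> t" "L * \<gamma> + t \<le> 1"
    using assms by (simp_all add: t_def field_simps add_pos_nonneg)
  have "0 \<le> L * \<gamma>"
    using assms by simp
  then have "t \<le> 1"
    using t by linarith
  then have "t\<^sup>2 \<le> t"
    using t by (simp add: power2_eq_square mult_left_le)
  moreover have "t\<^sup>2 = a * \<gamma>\<^sup>2"
    using assms by (simp add: t_def power_mult_distrib)
  ultimately show ?thesis
    using t by linarith
qed

text \<open>Reciprocals turn the minimum defining p into a maximum. The quotient (1 - p) / p is what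
  the Lyapunov argument produces, and the maximum is what the stepsize bound contains.\<close>

lemma inverse_probability:
  fixes d \<zeta> b b' p :: real
  assumes "0 < \<zeta>" "0 < d" "0 < b" "0 < b'" and p: "p = min (\<zeta> / d) (b' / (b + b'))"
  shows "1 / p = max (d / \<zeta>) (1 + b / b')" and "(1 - p) / p = max (d / \<zeta> - 1) (b / b')"
proof -
  have "0 < p"
    using assms by simp
  have 1: "1 / (\<zeta> / d) = d / \<zeta>" "1 / (b' / (b + b')) = 1 + b / b'"
    using assms by (simp_all add: field_simps)
  show *: "1 / p = max (d / \<zeta>) (1 + b / b')"
  proof (cases "\<zeta> / d \<le> b' / (b + b')")
    case True
    then have "1 / (b' / (b + b')) \<le> 1 / (\<zeta> / d)"
      using assms by (intro divide_left_mono) auto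
    with True show ?thesis
      unfolding p 1 by simp
  next
    case False
    then have "1 / (\<zeta> / d) \<le> 1 / (b' / (b + b'))"
      using assms by (intro divide_left_mono) auto
    with False show ?thesis
      unfolding p 1 using 1 by (simp add: min_def max_def)
  qed
  have "(1 - p) / p = 1 / p - 1"
    using \<open>0 < p\<close> by (simp add: field_simps)
  then show "(1 - p) / p = max (d / \<zeta> - 1) (b / b')"
    unfolding * by (simp add: max_def)
qed

text \<open>The bracket of the round bound, with s standing for
  \<open>\<sigma>sq / (n * b' * \<mu> * \<epsilon>)\<close>. The brackets of the other two bounds
  are its multiples by b' and by \<open>\<zeta>\<close>.\<close>

definition rounds_factor :: "real \<Rightarrow> real \<Rightarrow> real \<Rightarrow> real \<Rightarrow> real \<Rightarrow> real \<Rightarrow> real \<Rightarrow> real \<Rightarrow> real \<Rightarrow> real" where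
  "rounds_factor d \<zeta> s L \<L> \<mu> \<omega> n b' =
     max (d / \<zeta>) (max s
       (L / \<mu> * (1 + sqrt (\<omega> / n * max (d / \<zeta> - 1) s))
        + \<L> / \<mu> * sqrt ((1 + \<omega>) / (n * b') * max (d / \<zeta> - 1) s)))"

lemma inverse_stepsize:
  fixes d \<zeta> s L \<L> \<mu> \<omega> n b b' c2 p \<gamma> \<gamma>max \<theta> :: real
  assumes pos: "0 < \<zeta>" "\<zeta> \<le> d" "0 < n" "0 < b'" "b' \<le> b" "0 < \<mu>" "0 < \<omega>" "0 < L" "0 \<le> \<L>" "0 < s"
    and c2: "1 \<le> c2" "b / b' \<le> c2 * s"
    and p: "p = min (\<zeta> / d) (b' / (b + b'))"
    and \<gamma>max: "\<gamma>max = min (1 / (L + sqrt (2 * max (d / \<zeta> - 1) (b / b') / n * (\<omega> * L\<^sup>2 + (1 + \<omega>) * \<L>\<^sup>2 / b'))))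
        (p / (2 * \<mu>))"
    and \<theta>: "0 < \<theta>" "\<theta> * \<gamma>max \<le> \<gamma>"
  shows "0 < \<gamma>" and "1 / (\<gamma> * \<mu>) \<le> 4 * (1 + c2) * rounds_factor d \<zeta> s L \<L> \<mu> \<omega> n b' / \<theta>"
proof -
  define T where "T = rounds_factor d \<zeta> s L \<L> \<mu> \<omega> n b'"
  define mx where "mx = max (d / \<zeta> - 1) s"
  define u v where "u = sqrt (\<omega> / n * mx)" and "v = sqrt ((1 + \<omega>) / (n * b') * mx)"
  define A where "A = L + sqrt (2 * max (d / \<zeta> - 1) (b / b') / n * (\<omega> * L\<^sup>2 + (1 + \<omega>) * \<L>\<^sup>2 / b'))"
  have T: "d / \<zeta> \<le> T" "s \<le> T" "L / \<mu> * (1 + u) + \<L> / \<mu> * v \<le> T"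
    unfolding T_def rounds_factor_def u_def v_def mx_def by auto
  have "0 < T"
    using T(2) pos by linarith
  have mx: "0 < mx" "max (d / \<zeta> - 1) (b / b') \<le> c2 * mx"
  proof -
    show "0 < mx"
      using pos by (simp add: mx_def)
    have "1 * mx \<le> c2 * mx"
      using c2(1) \<open>0 < mx\<close> by (intro mult_right_mono) auto
    moreover have "c2 * s \<le> c2 * mx"
      using c2(1) by (simp add: mx_def)
    moreover have "d / \<zeta> - 1 \<le> mx"
      by (simp add: mx_def)
    ultimately show "max (d / \<zeta> - 1) (b / b') \<le> c2 * mx"
      using c2(2) by simp
  qed
  have uv: "0 \<le> u" "0 \<le> v"
    using pos mx(1) by (auto simp: u_def v_def)
  \<comment> \<open>\<open>u\<close> and \<open>v\<close> are the two roots in the claimed bound.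
    Replacing b / b' by \<open>c2 * s\<close> costs a factor \<open>c2\<close> under the root; it
    leaves the root through \<open>2 * c2 \<le> (1 + c2)\<^sup>2\<close>, and a sum of squares is at
    most the square of the sum.\<close>
  have "A \<le> L + (1 + c2) * (u * L + v * \<L>)"
  proof -
    have "2 * max (d / \<zeta> - 1) (b / b') / n * (\<omega> * L\<^sup>2 + (1 + \<omega>) * \<L>\<^sup>2 / b')
        \<le> 2 * (c2 * mx) / n * (\<omega> * L\<^sup>2 + (1 + \<omega>) * \<L>\<^sup>2 / b')"
      using mx pos by (intro mult_right_mono divide_right_mono mult_left_mono) auto
    also have "\<dots> = 2 * c2 * ((u * L)\<^sup>2 + (v * \<L>)\<^sup>2)"
      using pos mx(1) by (simp add: u_def v_def power_mult_distrib field_simps)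
    also have "\<dots> \<le> (1 + c2)\<^sup>2 * (u * L + v * \<L>)\<^sup>2"
    proof (rule mult_mono)
      show "2 * c2 \<le> (1 + c2)\<^sup>2"
        by (simp add: power2_sum)
      show "(u * L)\<^sup>2 + (v * \<L>)\<^sup>2 \<le> (u * L + v * \<L>)\<^sup>2"
        using pos uv by (simp add: power2_sum)
    qed auto
    finally have "2 * max (d / \<zeta> - 1) (b / b') / n * (\<omega> * L\<^sup>2 + (1 + \<omega>) * \<L>\<^sup>2 / b')
        \<le> ((1 + c2) * (u * L + v * \<L>))\<^sup>2"
      by (simp add: power_mult_distrib)
    then show ?thesis
      unfolding A_def using pos uv c2(1) by (intro add_left_mono real_le_lsqrt) auto
  qed
  also have "\<dots> \<le> (1 + c2) * (L + (u * L + v * \<L>))"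
    using c2(1) pos by (simp add: algebra_simps)
  also have "\<dots> = (1 + c2) * (\<mu> * (L / \<mu> * (1 + u) + \<L> / \<mu> * v))"
    using pos by (simp add: field_simps)
  also have "\<dots> \<le> (1 + c2) * (\<mu> * T)"
    using T(3) c2(1) pos by (intro mult_left_mono) auto
  also have "\<dots> \<le> 4 * (1 + c2) * (\<mu> * T)"
    using c2(1) pos \<open>0 < T\<close> by (intro mult_right_mono) auto
  finally have A_le: "A \<le> 4 * (1 + c2) * T * \<mu>"
    by (simp add: mult_ac)
  have "0 < A"
    unfolding A_def using pos by (intro add_pos_nonneg) (auto intro!: mult_nonneg_nonneg divide_nonneg_pos add_nonneg_nonneg
      simp: le_max_iff_disj)
  have p_pos: "0 < p"
    using pos p by simp
  have inv_p: "1 / p \<le> 2 * (1 + c2) * T"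
  proof -
    have "1 \<le> b / b'"
      using pos by simp
    then have "1 + b / b' \<le> 2 * c2 * s"
      using c2(2) by linarith
    also have "\<dots> \<le> 2 * c2 * T"
      using T(2) c2(1) by (intro mult_left_mono) auto
    also have "\<dots> \<le> 2 * (1 + c2) * T"
      using \<open>0 < T\<close> by (intro mult_right_mono) auto
    finally have "1 + b / b' \<le> 2 * (1 + c2) * T" .
    moreover have "1 * T \<le> 2 * (1 + c2) * T"
      using c2(1) \<open>0 < T\<close> by (intro mult_right_mono) auto
    moreover have "1 / p = max (d / \<zeta>) (1 + b / b')"
      using pos p by (intro inverse_probability(1)) auto
    ultimately show ?thesis
      using T(1) by simp
  qed
  \<comment> \<open>The second branch of the minimum dictates the 4: a factor 2 comes from the bound
    on 1 / p and another from \<open>p / (2 * \<mu>)\<close>.\<close>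
  have "1 / (4 * (1 + c2) * T * \<mu>) \<le> \<gamma>max"
    unfolding \<gamma>max A_def[symmetric]
  proof (rule min.boundedI)
    show "1 / (4 * (1 + c2) * T * \<mu>) \<le> 1 / A"
      using A_le \<open>0 < A\<close> by (intro divide_left_mono) auto
    have "1 / (2 * (1 + c2) * T) \<le> 1 / (1 / p)"
      using inv_p p_pos \<open>0 < T\<close> c2(1) by (intro divide_left_mono) auto
    then have "1 / (2 * (1 + c2) * T) / (2 * \<mu>) \<le> p / (2 * \<mu>)"
      using pos by (intro divide_right_mono) auto
    then show "1 / (4 * (1 + c2) * T * \<mu>) \<le> p / (2 * \<mu>)"
      by (simp add: mult_ac)
  qed
  then have "\<theta> * (1 / (4 * (1 + c2) * T * \<mu>)) \<le> \<theta> * \<gamma>max"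
    using \<theta> by (intro mult_left_mono) auto
  then have le: "\<theta> / (4 * (1 + c2) * T * \<mu>) \<le> \<gamma>"
    using \<theta>(2) by simp
  moreover have "0 < \<theta> / (4 * (1 + c2) * T * \<mu>)"
    using \<theta> pos \<open>0 < T\<close> c2(1) by simp
  ultimately show "0 < \<gamma>"
    by linarith
  have "\<theta> \<le> \<gamma> * (4 * (1 + c2) * T * \<mu>)"
    using le pos \<open>0 < T\<close> c2(1) by (simp add: pos_divide_le_eq)
  then show "1 / (\<gamma> * \<mu>) \<le> 4 * (1 + c2) * rounds_factor d \<zeta> s L \<L> \<mu> \<omega> n b' / \<theta>"
    unfolding T_def[symmetric] using \<theta> pos \<open>0 < \<gamma>\<close> by (simp add: divide_simps mult_ac)
qed

text \<open>Taken under a root, b' becomes its square: one factor enters the maximum, the other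
  stays beside \<open>\<omega>\<close> or cancels the b' in the denominator.\<close>

lemma oracle_factor:
  fixes d \<zeta> s L \<L> \<mu> \<omega> n b' :: real
  assumes "0 < b'"
  shows "b' * rounds_factor d \<zeta> s L \<L> \<mu> \<omega> n b' =
    max (b' * d / \<zeta>) (max (b' * s)
       (L / \<mu> * (b' + sqrt (\<omega> * b' / n * max ((d / \<zeta> - 1) * b') (b' * s)))
        + \<L> / \<mu> * sqrt ((1 + \<omega>) / n * max ((d / \<zeta> - 1) * b') (b' * s))))"
proof -
  define mx where "mx = max (d / \<zeta> - 1) s"
  have mx: "max ((d / \<zeta> - 1) * b') (b' * s) = b' * mx"
    using assms by (simp add: mx_def max_mult_distrib_left mult.commute)
  have scale: "b' * sqrt z = sqrt (b'\<^sup>2 * z)" for z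
    using assms by (simp add: real_sqrt_mult)
  have 1: "b' * sqrt (\<omega> / n * mx) = sqrt (\<omega> * b' / n * (b' * mx))"
    unfolding scale by (simp add: power2_eq_square mult_ac)
  have 2: "b' * sqrt ((1 + \<omega>) / (n * b') * mx) = sqrt ((1 + \<omega>) / n * (b' * mx))"
  proof -
    have "b'\<^sup>2 * ((1 + \<omega>) / (n * b') * mx) = b'\<^sup>2 / (n * b') * ((1 + \<omega>) * mx)"
      by simp
    also have "b'\<^sup>2 / (n * b') = b' / n"
      using assms by (simp add: power2_eq_square)
    finally show ?thesis
      unfolding scale by (simp add: mult_ac)
  qed
  have "b' * (L / \<mu> * (1 + sqrt (\<omega> / n * mx)) + \<L> / \<mu> * sqrt ((1 + \<omega>) / (n * b') * mx))
      = L / \<mu> * (b' + b' * sqrt (\<omega> / n * mx)) + \<L> / \<mu> * (b' * sqrt ((1 + \<omega>) / (n * b') * mx))"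
    by (simp add: algebra_simps)
  then show ?thesis
    unfolding rounds_factor_def mx mx_def[symmetric] 1 2
    using assms by (simp add: max_mult_distrib_left)
qed

text \<open>A single K serves all three bounds: the choice of p makes an average round cost at most
  3 b' calls and \<open>2 * \<zeta>\<close> components, so the cost bounds are multiples of the
  round bound once the initial batch and its message are absorbed.\<close>

theorem corollaryD4:
  fixes M :: "'w measure" and D :: "nat \<Rightarrow> 's measure" and R :: "'r measure"
    and F :: "'s \<Rightarrow> real ^ 'd::finite \<Rightarrow> real"
    and fi :: "nat \<Rightarrow> real ^ 'd \<Rightarrow> real" and f :: "real ^ 'd \<Rightarrow> real"
    and Q :: "'r \<Rightarrow> real ^ 'd \<Rightarrow> real ^ 'd"
    and I I' :: "nat \<Rightarrow> nat \<Rightarrow> nat set"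
    and c :: "nat \<Rightarrow> 'w \<Rightarrow> bool" and \<xi> :: "nat \<Rightarrow> nat \<Rightarrow> nat \<Rightarrow> 'w \<Rightarrow> 's"
    and r :: "nat \<Rightarrow> nat \<Rightarrow> 'w \<Rightarrow> 'r"
    and x g :: "nat \<Rightarrow> 'w \<Rightarrow> real ^ 'd" and gl dt m :: "nat \<Rightarrow> nat \<Rightarrow> 'w \<Rightarrow> real ^ 'd"
    and x0 xstar :: "real ^ 'd" and n b b' :: nat
    and d \<gamma> \<gamma>max p \<mu> \<omega> \<zeta> \<epsilon> \<Delta>0 L \<L> \<sigma>sq c1 c2 \<theta> \<rho> \<kappa> C :: real
    and Li \<L>i \<sigma>i :: "nat \<Rightarrow> real"
  assumes dim: "d = real CARD('d)" and n: "n \<ge> 1" and \<epsilon>: "\<epsilon> > 0"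
    \<comment> \<open>online problem\<close>
    and D: "\<And>i. i \<in> {1..n} \<Longrightarrow> prob_space (D i)"
    and F_integrable: "\<And>i z. i \<in> {1..n} \<Longrightarrow> integrable (D i) (\<lambda>s. F s z)"
    and F_diff: "\<And>i s z. i \<in> {1..n} \<Longrightarrow> s \<in> space (D i) \<Longrightarrow> F s differentiable (at z)"
    and F_grad_meas:
      "\<And>i. i \<in> {1..n} \<Longrightarrow> (\<lambda>(s, z). grad (F s) z) \<in> borel_measurable (D i \<Otimes>\<^sub>M borel)"
    and fi: "\<And>i z. i \<in> {1..n} \<Longrightarrow> fi i z = (LINT s|D i. F s z)"
    and f: "\<And>z. f z = (1 / real n) * (\<Sum>i=1..n. fi i z)"
    and lower: "\<exists>fstar. \<forall>z. f z \<ge> fstar"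
    and smooth: "\<And>i. i \<in> {1..n} \<Longrightarrow> smooth_with (Li i) (fi i)"
    and xstar: "is_arg_min f (\<lambda>_. True) xstar"
    and \<mu>: "\<mu> > 0"
    and PL: "\<And>z. (norm (grad f z))\<^sup>2 \<ge> 2 * \<mu> * (f z - f xstar)"
    and \<sigma>i: "\<And>i. i \<in> {1..n} \<Longrightarrow> \<sigma>i i \<ge> 0"
    and unbiased: "\<And>i z. i \<in> {1..n} \<Longrightarrow>
        integrable (D i) (\<lambda>s. grad (F s) z) \<and> (LINT s|D i. grad (F s) z) = grad (fi i) z"
    and variance: "\<And>i z. i \<in> {1..n} \<Longrightarrow>
        integrable (D i) (\<lambda>s. (norm (grad (F s) z - grad (fi i) z))\<^sup>2) \<and>
        (LINT s|D i. (norm (grad (F s) z - grad (fi i) z))\<^sup>2) \<le> (\<sigma>i i)\<^sup>2"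
    \<comment> \<open>quantization and algorithm\<close>
    and Q: "quantization R Q \<omega>" and \<zeta>: "\<zeta> = expected_density R Q"
    and batches: "b' \<ge> 1" "b' \<le> b"
        "\<And>i k. i \<in> {1..n} \<Longrightarrow> card (I i k) = b" "\<And>i k. i \<in> {1..n} \<Longrightarrow> card (I' i k) = b'"
    and p: "p = min (\<zeta> / d) (real b' / real (b + b'))"
    and sampling: "vr_marina_sampling M D R n p I I' c \<xi> r"
    and run: "vr_marina_run (space M) F Q n \<gamma> I I' x0 c \<xi> r x g gl dt m"
    and \<L>i: "\<And>i. i \<in> {1..n} \<Longrightarrow> \<L>i i \<ge> 0"
    and avg_smooth: "\<And>i. i \<in> {1..n} \<Longrightarrow> average_smooth M x (fi i) (dt i) b' (\<L>i i)"
    \<comment> \<open>derived constants\<close>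
    and L: "L = sqrt ((1 / real n) * (\<Sum>i=1..n. (Li i)\<^sup>2))"
    and \<L>: "\<L> = sqrt ((1 / real n) * (\<Sum>i=1..n. (\<L>i i)\<^sup>2))"
    and \<sigma>sq: "\<sigma>sq = (1 / real n) * (\<Sum>i=1..n. (\<sigma>i i)\<^sup>2)"
    and \<Delta>0: "\<Delta>0 = f x0 - f xstar"
    \<comment> \<open>stepsize, at most the bound and of its order\<close>
    and \<gamma>max: "\<gamma>max = min
        (1 / (L + sqrt (2 * max (d / \<zeta> - 1) (real b / real b') / real n
                         * (\<omega> * L\<^sup>2 + (1 + \<omega>) * \<L>\<^sup>2 / real b'))))
        (p / (2 * \<mu>))"
    and \<gamma>: "\<gamma> \<le> \<gamma>max" and \<theta>: "0 < \<theta>" "\<theta> \<le> 1" "\<theta> * \<gamma>max \<le> \<gamma>"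
    \<comment> \<open>batch size of order \<open>\<sigma>\<^sup>2/(n\<mu>\<epsilon>)\<close>, with a large enough constant\<close>
    and b_lower: "3 \<le> c1" "c1 * (\<sigma>sq / (real n * \<mu> * \<epsilon>)) \<le> real b"
    and b_upper: "real b \<le> c2 * (\<sigma>sq / (real n * \<mu> * \<epsilon>))" "c1 \<le> c2"
    \<comment> \<open>the logarithm is bounded away from 0\<close>
    and \<rho>: "1 < \<rho>" "\<rho> * \<epsilon> \<le> \<Delta>0"
    \<comment> \<open>communicating one non-zero component costs \<open>\<kappa>\<close>\<close>
    and \<kappa>: "\<kappa> > 0"
    and C: "C = hidden_factor c2 \<theta> \<rho>"
  shows "\<exists>K::nat.
      real K \<le> C *
        (max (d / \<zeta>) (max (\<sigma>sq / (real n * real b' * \<mu> * \<epsilon>))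
          (L / \<mu> * (1 + sqrt (\<omega> / real n
                * max (d / \<zeta> - 1) (\<sigma>sq / (real n * real b' * \<mu> * \<epsilon>))))
           + \<L> / \<mu> * sqrt ((1 + \<omega>) / (real n * real b')
                * max (d / \<zeta> - 1) (\<sigma>sq / (real n * real b' * \<mu> * \<epsilon>)))))
         * ln (\<Delta>0 / \<epsilon>)) \<and>
      integrable M (\<lambda>w. f (x K w) - f xstar) \<and>
      (LINT w|M. f (x K w) - f xstar) \<le> \<epsilon> \<and>
      (\<forall>i\<in>{1..n}.
        (LINT w|M. real (oracle_calls I I' c i K w)) \<le> C *
          (max (real b' * d / \<zeta>) (max (\<sigma>sq / (real n * \<mu> * \<epsilon>))
            (L / \<mu> * (real b' + sqrt (\<omega> * real b' / real n
                  * max ((d / \<zeta> - 1) * real b') (\<sigma>sq / (real n * \<mu> * \<epsilon>))))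
             + \<L> / \<mu> * sqrt ((1 + \<omega>) / real n
                  * max ((d / \<zeta> - 1) * real b') (\<sigma>sq / (real n * \<mu> * \<epsilon>)))))
           * ln (\<Delta>0 / \<epsilon>)) \<and>
        (LINT w|M. \<kappa> * real (sent_nonzeros m i K w)) \<le> C * \<kappa> *
          (\<zeta> * max (d / \<zeta>) (max (\<sigma>sq / (real n * real b' * \<mu> * \<epsilon>))
            (L / \<mu> * (1 + sqrt (\<omega> / real n
                  * max (d / \<zeta> - 1) (\<sigma>sq / (real n * real b' * \<mu> * \<epsilon>))))
             + \<L> / \<mu> * sqrt ((1 + \<omega>) / (real n * real b')
                  * max (d / \<zeta> - 1) (\<sigma>sq / (real n * real b' * \<mu> * \<epsilon>)))))
           * ln (\<Delta>0 / \<epsilon>)))"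
proof -
  define S where "S = \<sigma>sq / (real n * \<mu> * \<epsilon>)"
  define s where "s = \<sigma>sq / (real n * real b' * \<mu> * \<epsilon>)"
  define T where "T = rounds_factor d \<zeta> s L \<L> \<mu> \<omega> (real n) (real b')"
  define Lg where "Lg = ln (\<Delta>0 / \<epsilon>)"
  have \<omega>: "0 < \<omega>"
    using Q by (simp add: quantization_def)
  have \<zeta>_bounds: "0 < \<zeta>" "\<zeta> \<le> d"
    using expected_density_pos[OF Q] expected_density_le[OF Q] \<zeta> dim by simp_all
  then have d: "0 < d"
    by simp
  have nb: "0 < real n" "0 < real b'" "real b' \<le> real b" "0 < real b"
    using n batches by simp_all
  have p_bounds: "0 < p" "p \<le> 1"
    using \<zeta>_bounds d nb by (simp_all add: p min_le_iff_disj)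
  have c2: "3 \<le> c2"
    using b_lower(1) b_upper(2) by simp
  have "0 < c2 * S"
    using b_upper(1) nb(4) unfolding S_def by linarith
  then have S: "0 < S"
    using c2 by (simp add: zero_less_mult_iff)
  have s_eq: "real b' * s = S" "s = S / real b'"
    using nb by (simp_all add: s_def S_def)
  then have s: "0 < s"
    using S nb by simp
  have b_le: "real b / real b' \<le> c2 * s"
    using b_upper(1) nb unfolding s_eq(2) S_def[symmetric] by (simp add: divide_right_mono)
  interpret vr_marina M D R F fi f Q I I' c \<xi> r x g gl dt m x0 n b b' \<gamma> p \<omega> Li \<L>i \<sigma>i
    by (rule vr_marina.intro)
      (fact n less_imp_le[OF p_bounds(1)] p_bounds(2) D F_grad_meas f smooth unbiased variance Q batches
        sampling run avg_smooth)+
  have min: "f xstar \<le> f z" for z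
    using xstar by (auto simp: is_arg_min_def not_less)
  have smooth_f: "smooth_with L f"
    unfolding L by (rule smooth_with_mean[OF n f smooth])
  have "1 * \<epsilon> < \<rho> * \<epsilon>"
    using \<rho>(1) \<epsilon> by (rule mult_strict_right_mono)
  then have \<Delta>0_gt: "\<epsilon> < \<Delta>0"
    using \<rho>(2) by linarith
  have L_pos: "0 < L"
    by (rule PL_smooth_pos[OF smooth_f PL \<mu> min, of x0]) (use \<Delta>0_gt \<Delta>0 \<epsilon> in linarith)
  have \<L>_nonneg: "0 \<le> \<L>"
    unfolding \<L> by (intro real_sqrt_ge_zero mult_nonneg_nonneg sum_nonneg) auto
  have "1 \<le> c2"
    using c2 by simp
  note step = inverse_stepsize[OF \<zeta>_bounds nb(1,2,3) \<mu> \<omega> L_pos \<L>_nonneg s this b_le p[unfolded of_nat_add] \<gamma>max \<theta>(1,3),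
      folded T_def]
  have \<gamma>_pos: "0 < \<gamma>"
    by (rule step(1))
  have \<gamma>_le: "\<gamma> \<le> 1 / (L + sqrt (2 * max (d / \<zeta> - 1) (real b / real b') / real n
      * (\<omega> * L\<^sup>2 + (1 + \<omega>) * \<L>\<^sup>2 / real b')))" "\<gamma> \<le> p / (2 * \<mu>)"
    using \<gamma> unfolding \<gamma>max by simp_all
  have sq: "L\<^sup>2 = (1 / real n) * (\<Sum>i=1..n. (Li i)\<^sup>2)" "\<L>\<^sup>2 = (1 / real n) * (\<Sum>i=1..n. (\<L>i i)\<^sup>2)"
    unfolding L \<L> by (intro real_sqrt_pow2 mult_nonneg_nonneg sum_nonneg; simp)+
  \<comment> \<open>Identifies the radicand of the stepsize bound with the coefficient required by
    \<open>lyapunov_rate\<close>.\<close>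
  have a_eq: "2 * max (d / \<zeta> - 1) (real b / real b') / real n * (\<omega> * L\<^sup>2 + (1 + \<omega>) * \<L>\<^sup>2 / real b')
      = 2 * (1 - p) / p * step_const"
  proof -
    have "2 * (1 - p) / p * step_const = 2 * ((1 - p) / p) * step_const"
      by simp
    also have "(1 - p) / p = max (d / \<zeta> - 1) (real b / real b')"
      by (rule inverse_probability(2)[OF \<zeta>_bounds(1) d nb(4) nb(2) p[unfolded of_nat_add]])
    finally show ?thesis
      unfolding step_const_def sq by simp
  qed
  have step_const: "0 \<le> 2 * (1 - p) / p * step_const"
    unfolding a_eq[symmetric] using \<omega> nb
    by (intro mult_nonneg_nonneg add_nonneg_nonneg divide_nonneg_nonneg) (auto simp: le_max_iff_disj)
  have cond: "2 * (1 - p) / p * step_const * \<gamma>\<^sup>2 + L * \<gamma> \<le> 1"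
    by (rule stepsize_condition[OF L_pos step_const less_imp_le[OF \<gamma>_pos] \<gamma>_le(1)[unfolded a_eq]])
  have bv: "0 \<le> batch_var" "batch_var / \<mu> \<le> \<epsilon> / 3"
  proof -
    have eq: "batch_var = \<sigma>sq / (real n * real b)"
      by (simp add: batch_var_def \<sigma>sq)
    have \<sigma>sq_eq: "\<sigma>sq = S * (real n * \<mu> * \<epsilon>)"
      using nb \<mu> \<epsilon> by (simp add: S_def)
    show "0 \<le> batch_var"
      unfolding eq \<sigma>sq_eq using S nb \<mu> \<epsilon> by simp
    \<comment> \<open>The noise floor is \<open>S / real b * \<epsilon>\<close>, so the lower
      constant 3 on the batch size is what makes it at most a third of
      \<open>\<epsilon>\<close>.\<close>
    have "3 * S \<le> c1 * S"
      using b_lower(1) S by (intro mult_right_mono) auto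
    then have "3 * S \<le> real b"
      using b_lower(2) unfolding S_def by linarith
    then have "S / real b \<le> 1 / 3"
      using nb by (simp add: field_simps)
    then have "S / real b * \<epsilon> \<le> 1 / 3 * \<epsilon>"
      using \<epsilon> by (intro mult_right_mono) auto
    moreover have "batch_var / \<mu> = S / real b * \<epsilon>"
      unfolding eq \<sigma>sq_eq using nb \<mu> by simp
    ultimately show "batch_var / \<mu> \<le> \<epsilon> / 3"
      by simp
  qed
  define \<delta> where "\<delta> k = (LINT w|M. f (x k w) - f xstar)" for k
  note descent = E_descent[OF smooth_f PL \<gamma>_pos min]
  have rate: "\<delta> k + \<gamma> / p * mean_sq M (err k)
      \<le> (1 - \<gamma> * \<mu>) ^ k * (\<delta> 0 + \<gamma> / p * mean_sq M (err 0)) + batch_var / \<mu>" for k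
    by (rule lyapunov_rate[where L = L and B = step_const and r = "\<lambda>k. mean_sq M (dx k)"])
      (use descent(2) err_step(3)[OF iterates_square_integrable] mean_sq_nonneg p_bounds \<mu> \<gamma>_pos bv(1) \<gamma>_le(2) cond
        in \<open>auto simp: \<delta>_def\<close>)
  have "\<delta> 0 = (LINT w|M. \<Delta>0)"
    unfolding \<delta>_def \<Delta>0 by (intro Bochner_Integration.integral_cong) (auto simp: x_0)
  then have \<delta>0: "\<delta> 0 = \<Delta>0"
    by (simp add: prob_space)
  \<comment> \<open>Since \<open>\<gamma> / p\<close> is at most \<open>1 / (2 * \<mu>)\<close>, the
    initial error contributes at most half of the noise floor.\<close>
  have "\<gamma> / p * mean_sq M (err 0) \<le> 1 / (2 * \<mu>) * batch_var"
    using \<gamma>_le(2) p_bounds \<mu> err_0(2) mean_sq_nonneg[of M "err 0"]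
    by (intro mult_mono) (auto simp: field_simps)
  also have "\<dots> \<le> \<epsilon> / 6"
    using bv(2) by (simp add: mult.commute)
  finally have e0: "\<gamma> / p * mean_sq M (err 0) \<le> \<epsilon> / 6" .
  have "\<gamma> * \<mu> \<le> p / 2"
    using \<gamma>_le(2) \<mu> by (simp add: field_simps)
  then have q: "0 < \<gamma> * \<mu>" "\<gamma> * \<mu> \<le> 1 / 2"
    using \<gamma>_pos \<mu> p_bounds by simp_all
  obtain K :: nat where K: "real K \<le> 5 / 4 * (1 + 1 / ln \<rho>) * Lg / (\<gamma> * \<mu>)"
    and contr: "(1 - \<gamma> * \<mu>) ^ K * (\<Delta>0 + \<epsilon> / 6) \<le> 2 / 3 * \<epsilon>"
    unfolding Lg_def using iteration_count[OF q \<epsilon> \<rho>] by blast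
  have accuracy: "\<delta> K \<le> \<epsilon>"
  proof -
    have "0 \<le> \<gamma> / p * mean_sq M (err K)"
      using \<gamma>_pos p_bounds mean_sq_nonneg[of M "err K"] by simp
    then have "\<delta> K \<le> (1 - \<gamma> * \<mu>) ^ K * (\<Delta>0 + \<gamma> / p * mean_sq M (err 0)) + batch_var / \<mu>"
      using rate[of K] \<delta>0 by simp
    also have "\<dots> \<le> (1 - \<gamma> * \<mu>) ^ K * (\<Delta>0 + \<epsilon> / 6) + \<epsilon> / 3"
      using e0 bv(2) q by (intro add_mono mult_left_mono) auto
    finally show ?thesis
      using contr by simp
  qed
  \<comment> \<open>The factor 20 left out of \<open>H\<close> is a common upper bound for 5
    (rounds), 1 + 15 (oracle calls) and 1 + 10 (communication).\<close>
  define H where "H = (1 + c2) * (1 + 1 / ln \<rho>) / \<theta>"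
  have C_eq: "C = 20 * H"
    by (simp add: C hidden_factor_def H_def)
  have "\<rho> \<le> \<Delta>0 / \<epsilon>"
    using \<epsilon> \<rho> by (simp add: field_simps)
  then have ln_\<rho>: "0 < ln \<rho>" "ln \<rho> \<le> Lg"
    using \<rho> by (auto simp: Lg_def)
  have T: "d / \<zeta> \<le> T" "s \<le> T"
    by (simp_all add: T_def rounds_factor_def)
  then have "0 < T"
    using s by linarith
  \<comment> \<open>The summand 1 / ln \<open>\<rho>\<close> in the hidden factor keeps
    \<open>H * Lg\<close> away from 0 even if the logarithm is small; one-off initial costs can
    therefore be charged to the bounds.\<close>
  have H_Lg: "1 + c2 \<le> H * Lg"
  proof -
    have "1 \<le> Lg / ln \<rho>"
      using ln_\<rho> by simp
    then have "1 \<le> Lg + Lg / ln \<rho>"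
      using ln_\<rho> by linarith
    then have "1 \<le> (1 + 1 / ln \<rho>) * Lg"
      by (simp add: distrib_right)
    then have "(1 + c2) * 1 \<le> (1 + c2) * ((1 + 1 / ln \<rho>) * Lg)"
      using c2 by (intro mult_left_mono) auto
    also have "\<dots> = H * Lg * \<theta>"
      using \<theta> by (simp add: H_def)
    also have "\<dots> \<le> H * Lg * 1"
      using \<theta> c2 ln_\<rho> by (intro mult_left_mono) (auto simp: H_def)
    finally show ?thesis
      by simp
  qed
  have K_le: "real K \<le> 5 * (H * T * Lg)"
  proof -
    have "real K \<le> 5 / 4 * (1 + 1 / ln \<rho>) * Lg * (1 / (\<gamma> * \<mu>))"
      using K by simp
    also have "\<dots> \<le> 5 / 4 * (1 + 1 / ln \<rho>) * Lg * (4 * (1 + c2) * T / \<theta>)"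
      using step(2) ln_\<rho> by (intro mult_left_mono) auto
    also have "5 / 4 * u * Lg * (4 * v * T / \<theta>) = 5 * (v * u / \<theta> * T * Lg)" for u v
      by simp
    also have "(1 + c2) * (1 + 1 / ln \<rho>) / \<theta> = H"
      by (simp add: H_def)
    finally show ?thesis .
  qed
  have HTL: "T \<le> H * T * Lg" "c2 * T \<le> H * T * Lg" "0 \<le> H * T * Lg"
  proof -
    have "(1 + c2) * T \<le> (H * Lg) * T"
      using H_Lg \<open>0 < T\<close> by (intro mult_right_mono) auto
    then have *: "T + c2 * T \<le> H * T * Lg"
      by (simp add: algebra_simps)
    moreover have "0 \<le> c2 * T"
      using c2 \<open>0 < T\<close> by simp
    ultimately show "T \<le> H * T * Lg" "c2 * T \<le> H * T * Lg" "0 \<le> H * T * Lg"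
      using \<open>0 < T\<close> by linarith+
  qed
  have calls: "(LINT w|M. real (oracle_calls I I' c i K w)) \<le> C * (real b' * T * Lg)" if i: "i \<in> {1..n}" for i
  proof -
    \<comment> \<open>The second entry of the minimum defining p balances the rounds: a full batch
      costs at most b' calls on average, beside at most 2 b' for quantized rounds.\<close>
    have "p * real b \<le> real b'"
    proof -
      have "p * real b \<le> real b' / real (b + b') * real b"
        using nb by (intro mult_right_mono) (auto simp: p)
      also have "\<dots> \<le> real b'"
        using nb by (simp add: field_simps)
      finally show ?thesis .
    qed
    moreover have "(1 - p) * (2 * real b') \<le> 1 * (2 * real b')"
      using p_bounds nb by (intro mult_right_mono) auto
    ultimately have "real K * (p * real b + (1 - p) * (2 * real b')) \<le> real K * (3 * real b')"
      by (intro mult_left_mono) auto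
    also have "\<dots> \<le> 5 * (H * T * Lg) * (3 * real b')"
      using K_le nb by (intro mult_right_mono) auto
    also have "\<dots> = 15 * (real b' * (H * T * Lg))"
      by simp
    finally have "real K * (p * real b + (1 - p) * (2 * real b')) \<le> 15 * (real b' * (H * T * Lg))" .
    \<comment> \<open>The initial batch is always paid in full; the upper constant \<open>c2\<close>
      compares it with \<open>real b' * s\<close>.\<close>
    moreover have "real b \<le> real b' * (H * T * Lg)"
    proof -
      have "real b \<le> real b' * (c2 * s)"
        using b_le nb by (simp add: field_simps)
      also have "\<dots> \<le> real b' * (c2 * T)"
        using T(2) c2 by (intro mult_left_mono) auto
      also have "\<dots> \<le> real b' * (H * T * Lg)"
        using HTL(2) by (intro mult_left_mono) auto
      finally show ?thesis .
    qed
    moreover have "0 \<le> real b' * (H * T * Lg)"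
      using HTL(3) by simp
    ultimately have "(LINT w|M. real (oracle_calls I I' c i K w)) \<le> 20 * (real b' * (H * T * Lg))"
      unfolding E_oracle_calls[OF i] by linarith
    then show ?thesis
      by (simp add: C_eq mult_ac)
  qed
  have communication: "(LINT w|M. \<kappa> * real (sent_nonzeros m i K w)) \<le> C * \<kappa> * (\<zeta> * T * Lg)"
    if i: "i \<in> {1..n}" for i
  proof -
    \<comment> \<open>The first entry of the minimum plays the same part for communication: dense
      messages cost \<open>\<zeta>\<close> on average, as much as quantized ones may.\<close>
    have "p * d \<le> \<zeta> / d * d"
      using d by (intro mult_right_mono) (auto simp: p)
    moreover have "(1 - p) * \<zeta> \<le> 1 * \<zeta>"
      using p_bounds \<zeta>_bounds by (intro mult_right_mono) auto
    ultimately have "real K * (p * d + (1 - p) * \<zeta>) \<le> real K * (2 * \<zeta>)"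
      using d by (intro mult_left_mono) auto
    also have "\<dots> \<le> 5 * (H * T * Lg) * (2 * \<zeta>)"
      using K_le \<zeta>_bounds by (intro mult_right_mono) auto
    also have "\<dots> = 10 * (\<zeta> * (H * T * Lg))"
      by simp
    finally have "real K * (p * d + (1 - p) * \<zeta>) \<le> 10 * (\<zeta> * (H * T * Lg))" .
    moreover have "d \<le> \<zeta> * (H * T * Lg)"
    proof -
      have "d \<le> \<zeta> * T"
        using T(1) \<zeta>_bounds by (simp add: field_simps)
      also have "\<dots> \<le> \<zeta> * (H * T * Lg)"
        using HTL(1) \<zeta>_bounds by (intro mult_left_mono) auto
      finally show ?thesis .
    qed
    moreover have "0 \<le> \<zeta> * (H * T * Lg)"
      using HTL(3) \<zeta>_bounds by simp
    ultimately have "(LINT w|M. real (sent_nonzeros m i K w)) \<le> 20 * (\<zeta> * (H * T * Lg))"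
      using E_sent_nonzeros[OF i, of K] unfolding dim[symmetric] \<zeta>[symmetric] by linarith
    then have "\<kappa> * (LINT w|M. real (sent_nonzeros m i K w)) \<le> \<kappa> * (20 * (\<zeta> * (H * T * Lg)))"
      using \<kappa> by (intro mult_left_mono) auto
    then show ?thesis
      by (simp add: C_eq mult_ac)
  qed
  have rounds: "real K \<le> C * (T * Lg)"
    using K_le HTL(3) by (simp add: C_eq mult_ac)
  have integrable: "integrable M (\<lambda>w. f (x K w) - f xstar)"
    by (rule descent(1))
  show ?thesis
    using rounds integrable accuracy calls communication
    unfolding oracle_factor[OF nb(2), of d \<zeta> s L \<L> \<mu> \<omega> "real n", folded T_def]
      s_eq(1) \<delta>_def
    unfolding T_def rounds_factor_def Lg_def s_def S_def by blast
qed

end
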